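(* Let $l\ge 2$ and let $L_{rel}$, $\mathbf{C}_n$, $\mathbf{S}_n$ and the $L_{rel}$-formula $\xi(y,z)$ be as in the context. Let $f:\mathbb{N}\to\mathbb{R}$ be such that $\lim_{n\to\infty}f(n)/\ln n=\infty$. Suppose that the proportion of $\mathcal{M}\in\mathbf{C}_n$ which have an $f(n)$-rich $l$-colouring approaches $1$ as $n\to\infty$. Then the proportion of $\mathcal{M}\in\mathbf{C}_n$ such that every $l$-colouring $\gamma$ of $\mathcal{M}$ is definable by $\xi(y,z)$, in the sense that for all $a,b\in M$, $\mathcal{M}\models\xi(a,b)\Leftrightarrow\gamma(a)=\gamma(b)$, approaches $1$ as $n\to\infty$. Consequently, the proportion of $\mathcal{M}\in\mathbf{C}_n$ which have a unique $l$-colouring, up to permutation of colours, approaches $1$ as $n\to\infty$. If every relation symbol of $L_{rel}$ has arity at most $l$, the same statements hold if $\mathbf{C}_n$ is replaced by $\mathbf{S}_n$ and $l$-colourings by strong $l$-colourings (in which case the formula $\xi(y,z)$ may be different).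
   Context: $l\ge2$ is a fixed integer. $L_{rel}$ is a first-order language with finite nonempty relational vocabulary, all symbols of arity at least $2$. An $l$-colouring of an $L_{rel}$-structure $\mathcal{M}$ is a function $\gamma:M\to\{1,\ldots,l\}$ such that whenever $R$ is a relation symbol and $(a_1,\ldots,a_m)\in R^{\mathcal{M}}$, there are $i,j$ with $\gamma(a_i)\ne\gamma(a_j)$; it is a strong $l$-colouring if whenever $(a_1,\ldots,a_m)\in R^{\mathcal{M}}$, $\gamma(a_i)\neq\gamma(a_j)$ for all $i\ne j$. $\mathcal{M}$ is (strongly) $l$-colourable if it has a (strong) $l$-colouring. $\gamma$ is $m$-rich ($m\in\mathbb{R}$) if $|\gamma^{-1}(i)|\ge m$ for all $i\in\{1,\ldots,l\}$. $\mathbf{C}_n$ (respectively $\mathbf{S}_n$) is the set of all $l$-colourable (respectively strongly $l$-colourable) $L_{rel}$-structures with universe $\{1,\ldots,n\}$. Proportions refer to the uniform probability measure. The formula $\xi$: fix an $l$-colourable (in the strong case: strongly $l$-colourable) $L_{rel}$-structure $\mathcal{S}$ with universe $\{1,\ldots,s\}$, $s\ge3$, such that every (strong) $l$-colouring of $\mathcal{S}$ gives $s-1$ and $s$ the same colour, and for every $i\in\{1,\ldots,l\}$ there is a (strong) $l$-colouring of $\mathcal{S}$ giving both $s-1$ and $s$ the colour $i$ (such $\mathcal{S}$ exists). Let $\chi_{\mathcal{S}}(x_1,\ldots,x_s)$ be a quantifier-free $L_{rel}$-formula such that $\mathcal{M}\models\chi_{\mathcal{S}}(a_1,\ldots,a_s)$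 iff $a_i\mapsto i$ is an isomorphism from $\mathcal{M}\upharpoonright\{a_1,\ldots,a_s\}$ to $\mathcal{S}$. Then $\xi(y,z)$ is the formula $y=z\vee\exists u_1,\ldots,u_{s-2}\,\chi_{\mathcal{S}}(u_1,\ldots,u_{s-2},y,z)$. *)

theory Defs
  imports Complex_Main
begin

text \<open>
  The vocabulary is a type \<open>'r\<close> of relation symbols (of class \<open>finite\<close> in the theorem) with an
  arity function \<open>ar :: 'r \<Rightarrow> nat\<close>. Tuples are lists.
\<close>

record ('r, 'a) rstruct =
  universe :: "'a set"
  interp :: "'r \<Rightarrow> 'a list set"

definition is_struct :: "('r \<Rightarrow> nat) \<Rightarrow> ('r, 'a) rstruct \<Rightarrow> bool" where
  "is_struct ar M \<longleftrightarrow>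
     (\<forall>R. \<forall>xs \<in> interp M R. length xs = ar R \<and> set xs \<subseteq> universe M)"

definition induced :: "('r, 'a) rstruct \<Rightarrow> 'a set \<Rightarrow> ('r, 'a) rstruct" where
  "induced M X = \<lparr>universe = X, interp = (\<lambda>R. {xs \<in> interp M R. set xs \<subseteq> X})\<rparr>"

definition is_iso :: "('r \<Rightarrow> nat) \<Rightarrow> ('a \<Rightarrow> 'b) \<Rightarrow> ('r, 'a) rstruct \<Rightarrow> ('r, 'b) rstruct \<Rightarrow> bool" where
  "is_iso ar h A B \<longleftrightarrow>
     bij_betw h (universe A) (universe B) \<and>
     (\<forall>R xs. length xs = ar R \<and> set xs \<subseteq> universe A \<longrightarrow>
        (xs \<in> interp A R \<longleftrightarrow> map h xs \<in> interp B R))"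

subsection \<open>First-order formulas\<close>

text \<open>Variables are natural numbers; the variable \<open>i\<close> plays the role of \<open>x\<^sub>i\<close>.\<close>

datatype 'r fm =
    Equal nat nat
  | Rel 'r "nat list"
  | Neg "'r fm"
  | Conj "'r fm" "'r fm"
  | Disj "'r fm" "'r fm"
  | Exists nat "'r fm"

primrec sat :: "('r, 'a) rstruct \<Rightarrow> (nat \<Rightarrow> 'a) \<Rightarrow> 'r fm \<Rightarrow> bool" where
  "sat M v (Equal x y) \<longleftrightarrow> v x = v y"
| "sat M v (Rel R xs) \<longleftrightarrow> map v xs \<in> interp M R"
| "sat M v (Neg \<phi>) \<longleftrightarrow> \<not> sat M v \<phi>"
| "sat M v (Conj \<phi> \<psi>) \<longleftrightarrow> sat M v \<phi> \<and> sat M v \<psi>"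
| "sat M v (Disj \<phi> \<psi>) \<longleftrightarrow> sat M v \<phi> \<or> sat M v \<psi>"
| "sat M v (Exists x \<phi>) \<longleftrightarrow> (\<exists>a \<in> universe M. sat M (v(x := a)) \<phi>)"

primrec wf_fm :: "('r \<Rightarrow> nat) \<Rightarrow> 'r fm \<Rightarrow> bool" where
  "wf_fm ar (Equal x y) \<longleftrightarrow> True"
| "wf_fm ar (Rel R xs) \<longleftrightarrow> length xs = ar R"
| "wf_fm ar (Neg \<phi>) \<longleftrightarrow> wf_fm ar \<phi>"
| "wf_fm ar (Conj \<phi> \<psi>) \<longleftrightarrow> wf_fm ar \<phi> \<and> wf_fm ar \<psi>"
| "wf_fm ar (Disj \<phi> \<psi>) \<longleftrightarrow> wf_fm ar \<phi> \<and> wf_fm ar \<psi>"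
| "wf_fm ar (Exists x \<phi>) \<longleftrightarrow> wf_fm ar \<phi>"

primrec free_vars :: "'r fm \<Rightarrow> nat set" where
  "free_vars (Equal x y) = {x, y}"
| "free_vars (Rel R xs) = set xs"
| "free_vars (Neg \<phi>) = free_vars \<phi>"
| "free_vars (Conj \<phi> \<psi>) = free_vars \<phi> \<union> free_vars \<psi>"
| "free_vars (Disj \<phi> \<psi>) = free_vars \<phi> \<union> free_vars \<psi>"
| "free_vars (Exists x \<phi>) = free_vars \<phi> - {x}"

primrec quantifier_free :: "'r fm \<Rightarrow> bool" where
  "quantifier_free (Equal x y) \<longleftrightarrow> True"
| "quantifier_free (Rel R xs) \<longleftrightarrow> True"
| "quantifier_free (Neg \<phi>) \<longleftrightarrow> quantifier_free \<phi>"
| "quantifier_free (Conj \<phi> \<psi>) \<longleftrightarrow> quantifier_free \<phi> \<and> quantifier_free \<psi>"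
| "quantifier_free (Disj \<phi> \<psi>) \<longleftrightarrow> quantifier_free \<phi> \<and> quantifier_free \<psi>"
| "quantifier_free (Exists x \<phi>) \<longleftrightarrow> False"

subsection \<open>Colourings\<close>

text \<open>
  A colouring is a total function of which only the restriction to the universe is relevant.
\<close>

definition colouring :: "nat \<Rightarrow> ('r, 'a) rstruct \<Rightarrow> ('a \<Rightarrow> nat) \<Rightarrow> bool" where
  "colouring l M \<gamma> \<longleftrightarrow>
     (\<forall>a \<in> universe M. \<gamma> a \<in> {1..l}) \<and>
     (\<forall>R. \<forall>xs \<in> interp M R. \<exists>i < length xs. \<exists>j < length xs. \<gamma> (xs ! i) \<noteq> \<gamma> (xs ! j))"

definition strong_colouring :: "nat \<Rightarrow> ('r, 'a) rstruct \<Rightarrow> ('a \<Rightarrow> nat) \<Rightarrow> bool" where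
  "strong_colouring l M \<gamma> \<longleftrightarrow>
     (\<forall>a \<in> universe M. \<gamma> a \<in> {1..l}) \<and>
     (\<forall>R. \<forall>xs \<in> interp M R. \<forall>i < length xs. \<forall>j < length xs. i \<noteq> j \<longrightarrow> \<gamma> (xs ! i) \<noteq> \<gamma> (xs ! j))"

definition rich :: "nat \<Rightarrow> real \<Rightarrow> ('r, 'a) rstruct \<Rightarrow> ('a \<Rightarrow> nat) \<Rightarrow> bool" where
  "rich l m M \<gamma> \<longleftrightarrow> (\<forall>i \<in> {1..l}. real (card {a \<in> universe M. \<gamma> a = i}) \<ge> m)"

text \<open>
  Below, the parameter \<open>col\<close> stands for either \<open>colouring\<close> or \<open>strong_colouring\<close>, so that
  \<open>colourables ar colouring l n\<close> is \<open>\<^bold>C\<^sub>n\<close> and \<open>colourables ar strong_colouring l n\<close> is \<open>\<^bold>S\<^sub>n\<close>.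
\<close>

type_synonym 'r colouring_notion = "nat \<Rightarrow> ('r, nat) rstruct \<Rightarrow> (nat \<Rightarrow> nat) \<Rightarrow> bool"

definition colourables ::
    "('r \<Rightarrow> nat) \<Rightarrow> 'r colouring_notion \<Rightarrow> nat \<Rightarrow> nat \<Rightarrow> ('r, nat) rstruct set" where
  "colourables ar col l n =
     {M. is_struct ar M \<and> universe M = {1..n} \<and> (\<exists>\<gamma>. col l M \<gamma>)}"

definition proportion :: "'b set \<Rightarrow> ('b \<Rightarrow> bool) \<Rightarrow> real" where
  "proportion A P = real (card {x \<in> A. P x}) / real (card A)"

definition unique_colouring :: "'r colouring_notion \<Rightarrow> nat \<Rightarrow> ('r, nat) rstruct \<Rightarrow> bool" where
  "unique_colouring col l M \<longleftrightarrow>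
     (\<exists>\<gamma>. col l M \<gamma>) \<and>
     (\<forall>\<gamma> \<gamma>'. col l M \<gamma> \<and> col l M \<gamma>' \<longrightarrow>
        (\<exists>p. bij_betw p {1..l} {1..l} \<and> (\<forall>a \<in> universe M. \<gamma>' a = p (\<gamma> a))))"

subsection \<open>The formula \<open>\<xi>\<close>\<close>

definition forcing_struct ::
    "('r \<Rightarrow> nat) \<Rightarrow> 'r colouring_notion \<Rightarrow> nat \<Rightarrow> nat \<Rightarrow> ('r, nat) rstruct \<Rightarrow> bool" where
  "forcing_struct ar col l s S \<longleftrightarrow>
     3 \<le> s \<and> is_struct ar S \<and> universe S = {1..s} \<and> (\<exists>\<gamma>. col l S \<gamma>) \<and>
     (\<forall>\<gamma>. col l S \<gamma> \<longrightarrow> \<gamma> (s - 1) = \<gamma> s) \<and>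
     (\<forall>i \<in> {1..l}. \<exists>\<gamma>. col l S \<gamma> \<and> \<gamma> (s - 1) = i \<and> \<gamma> s = i)"

text \<open>
  \<open>\<chi>\<close> is a quantifier-free formula \<open>\<chi>\<^sub>S(x\<^sub>1,\<dots>,x\<^sub>s)\<close> expressing that \<open>x\<^sub>i \<mapsto> i\<close> is an isomorphism onto \<open>S\<close>.
  Only structures on sets of natural numbers are tested; since \<open>\<chi>\<close> is quantifier-free,
  whether it holds depends only on the finite substructure on \<open>v ` {1..s}\<close>, so this is no
  restriction.
\<close>

definition describes ::
    "('r \<Rightarrow> nat) \<Rightarrow> nat \<Rightarrow> ('r, nat) rstruct \<Rightarrow> 'r fm \<Rightarrow> bool" where
  "describes ar s S \<chi> \<longleftrightarrow>
     wf_fm ar \<chi> \<and> quantifier_free \<chi> \<and> free_vars \<chi> \<subseteq> {1..s} \<and>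
     (\<forall>(M :: ('r, nat) rstruct) v. is_struct ar M \<and> v ` {1..s} \<subseteq> universe M \<longrightarrow>
        (sat M v \<chi> \<longleftrightarrow>
           (\<exists>h. (\<forall>i \<in> {1..s}. h (v i) = i) \<and> is_iso ar h (induced M (v ` {1..s})) S)))"

text \<open>
  The variables \<open>x\<^sub>1,\<dots>,x\<^sub>s\<^sub>-\<^sub>2\<close> serve as \<open>u\<^sub>1,\<dots>,u\<^sub>s\<^sub>-\<^sub>2\<close>, and \<open>y\<close>, \<open>z\<close> are \<open>x\<^sub>s\<^sub>-\<^sub>1\<close>, \<open>x\<^sub>s\<close>.
\<close>

definition xi :: "nat \<Rightarrow> 'r fm \<Rightarrow> 'r fm" where
  "xi s \<chi> = Disj (Equal (s - 1) s) (foldr Exists [1..<s - 1] \<chi>)"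

definition definable_by ::
    "'r fm \<Rightarrow> nat \<Rightarrow> nat \<Rightarrow> ('r, nat) rstruct \<Rightarrow> (nat \<Rightarrow> nat) \<Rightarrow> bool" where
  "definable_by \<phi> y z M \<gamma> \<longleftrightarrow>
     (\<forall>a \<in> universe M. \<forall>b \<in> universe M. \<forall>v.
        sat M (v(y := a, z := b)) \<phi> \<longleftrightarrow> \<gamma> a = \<gamma> b)"

end

theory Submission
  imports Defs "HOL-Library.FuncSet" "HOL-Combinatorics.Transposition"
begin

text \<open>
  Fix a colouring \<open>\<gamma>\<close> all of whose classes have size at least \<open>m\<close>. A uniformly random structure
  coloured by \<open>\<gamma>\<close> contains each admissible tuple independently with probability \<open>1/2\<close>. For
  \<open>a \<noteq> b\<close> of the same colour there are about \<open>m / s\<close> candidate copies of \<open>S\<close> with \<open>s - 1, s\<close>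
  placed at \<open>a, b\<close> which pairwise share no admissible tuple, so none of them is realised with probability
  at most \<open>q ^ (m / s)\<close> for a constant \<open>q < 1\<close>. Since \<open>m / ln n \<rightarrow> \<infinity>\<close>, with high probability all
  pairs of equal colour are linked by a copy of \<open>S\<close>, and any two colours are separated by some tuple;
  call \<open>\<gamma>\<close> good for the structure in that case.
  If \<open>\<gamma>\<close> is good, every colouring is \<open>\<gamma>\<close> followed by a permutation of colours. Hence a structure
  has at most \<open>l ^ l\<close> good colourings, and this bounds the number of all pairs (structure, rich
  colouring) by a constant times the number of structures, because almost all these pairs are good.
  So only a vanishing proportion of structures has a rich colouring but no good one.
\<close>

subsection \<open>Satisfaction of \<open>\<xi>\<close>\<close>

text \<open>A copy of \<open>S\<close> in \<open>M\<close> as a map from \<open>S\<close> into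
  \<open>M\<close>, the direction in which copies are built later; \<open>describes\<close> speaks
  of the inverse map.\<close>

definition embeds ::
    "('r \<Rightarrow> nat) \<Rightarrow> nat \<Rightarrow> ('r, nat) rstruct \<Rightarrow> ('r, nat) rstruct \<Rightarrow> (nat \<Rightarrow> nat) \<Rightarrow> bool" where
  "embeds ar s S M w \<longleftrightarrow> inj_on w {1..s} \<and> w ` {1..s} \<subseteq> universe M \<and>
     (\<forall>R ys. length ys = ar R \<and> set ys \<subseteq> {1..s} \<longrightarrow>
        (map w ys \<in> interp M R \<longleftrightarrow> ys \<in> interp S R))"

text \<open>The condition \<open>h (w i) = i\<close> forces \<open>h\<close> to be the inverse of
  \<open>w\<close> on its image, so such an isomorphism exists exactly when \<open>w\<close> is
  injective and respects the relations both ways.\<close>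

lemma sat_describes:
  assumes d: "describes ar s S \<chi>" and M: "is_struct ar M" and w: "w ` {1..s} \<subseteq> universe M"
    and S: "universe S = {1..s}"
  shows "sat M w \<chi> \<longleftrightarrow> embeds ar s S M w"
proof -
  have "sat M w \<chi> \<longleftrightarrow>
    (\<exists>h. (\<forall>i \<in> {1..s}. h (w i) = i) \<and> is_iso ar h (induced M (w ` {1..s})) S)"
    using d M w unfolding describes_def by blast
  also have "\<dots> \<longleftrightarrow> embeds ar s S M w"
  proof
    assume "\<exists>h. (\<forall>i \<in> {1..s}. h (w i) = i) \<and> is_iso ar h (induced M (w ` {1..s})) S"
    then obtain h where h: "\<And>i. i \<in> {1..s} \<Longrightarrow> h (w i) = i"
      and iso: "is_iso ar h (induced M (w ` {1..s})) S" by blast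
    have inj: "inj_on w {1..s}" using h by (metis inj_on_inverseI)
    have "map w ys \<in> interp M R \<longleftrightarrow> ys \<in> interp S R"
      if "length ys = ar R" "set ys \<subseteq> {1..s}" for R ys
    proof -
      have 1: "map h (map w ys) = ys" using that(2) h by (auto intro!: map_idI)
      have "length (map w ys) = ar R \<and> set (map w ys) \<subseteq> w ` {1..s}" using that by auto
      then have "map w ys \<in> interp (induced M (w ` {1..s})) R \<longleftrightarrow> map h (map w ys) \<in> interp S R"
        using iso unfolding is_iso_def by (simp add: induced_def)
      moreover have "map w ys \<in> interp (induced M (w ` {1..s})) R \<longleftrightarrow> map w ys \<in> interp M R"
        using that by (auto simp: induced_def)
      ultimately show ?thesis using 1 by simp
    qed
    then show "embeds ar s S M w" using inj w by (auto simp: embeds_def)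
  next
    assume e: "embeds ar s S M w"
    then have inj: "inj_on w {1..s}" by (simp add: embeds_def)
    define h where "h = inv_into {1..s} w"
    have h: "h (w i) = i" if "i \<in> {1..s}" for i
      using inj that by (simp add: h_def)
    have wh: "w (h x) = x" "h x \<in> {1..s}" if "x \<in> w ` {1..s}" for x
      using that h by auto
    have "is_iso ar h (induced M (w ` {1..s})) S"
      unfolding is_iso_def
    proof (intro conjI allI impI)
      show "bij_betw h (universe (induced M (w ` {1..s}))) (universe S)"
        using inj by (simp add: induced_def S h_def inj_on_imp_bij_betw bij_betw_inv_into)
      fix R xs
      assume a: "length xs = ar R \<and> set xs \<subseteq> universe (induced M (w ` {1..s}))"
      then have sub: "set xs \<subseteq> w ` {1..s}" by (simp add: induced_def)
      have "map w (map h xs) = xs" using sub wh by (auto intro!: map_idI)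
      moreover have "set (map h xs) \<subseteq> {1..s}" using sub wh(2) by fastforce
      ultimately show "xs \<in> interp (induced M (w ` {1..s})) R \<longleftrightarrow> map h xs \<in> interp S R"
        using e a sub unfolding embeds_def
        by (metis (no_types, lifting) induced_def length_map mem_Collect_eq select_convs(2))
    qed
    with h show "\<exists>h. (\<forall>i \<in> {1..s}. h (w i) = i) \<and> is_iso ar h (induced M (w ` {1..s})) S"
      by blast
  qed
  finally show ?thesis .
qed

lemma sat_foldr_Exists:
  "sat M v (foldr Exists xs \<phi>) \<longleftrightarrow>
     (\<exists>w. (\<forall>x. x \<notin> set xs \<longrightarrow> w x = v x) \<and> (\<forall>x \<in> set xs. w x \<in> universe M) \<and> sat M w \<phi>)"
proof (induction xs arbitrary: v)
  case Nil
  have "w = v" if "\<forall>x. w x = v x" for w using that by auto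
  then show ?case by auto
next
  case (Cons y xs)
  show ?case (is "?L \<longleftrightarrow> ?R")
  proof
    assume ?L
    then obtain a w where a: "a \<in> universe M" "\<forall>x. x \<notin> set xs \<longrightarrow> w x = (v(y := a)) x"
      "\<forall>x \<in> set xs. w x \<in> universe M" "sat M w \<phi>"
      using Cons.IH by auto
    \<comment> \<open>If \<open>y\<close> occurs again in \<open>xs\<close>, an inner quantifier
      overwrites \<open>a\<close>, so \<open>w y\<close> need not be \<open>a\<close>.\<close>
    have "w y \<in> universe M" using a by (cases "y \<in> set xs") auto
    then show ?R using a by (intro exI[of _ w]) auto
  next
    assume ?R
    then obtain w where w: "\<forall>x. x \<notin> set (y # xs) \<longrightarrow> w x = v x"
      "\<forall>x \<in> set (y # xs). w x \<in> universe M" "sat M w \<phi>" by blast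
    have "sat M (v(y := w y)) (foldr Exists xs \<phi>)"
      unfolding Cons.IH using w by (intro exI[of _ w]) auto
    then show ?L using w(2) by auto
  qed
qed

lemma sat_xi:
  assumes d: "describes ar s S \<chi>" and M: "is_struct ar M"
    and S: "universe S = {1..s}" and s: "3 \<le> s"
    and ab: "a \<in> universe M" "b \<in> universe M"
  shows "sat M (v(s - 1 := a, s := b)) (xi s \<chi>) \<longleftrightarrow>
     a = b \<or> (\<exists>w. embeds ar s S M w \<and> w (s - 1) = a \<and> w s = b)"
proof -
  have set_eq: "{1..s} = set [1..<s - 1] \<union> {s - 1, s}" using s by auto
  have "sat M (v(s - 1 := a, s := b)) (foldr Exists [1..<s - 1] \<chi>) \<longleftrightarrow>
     (\<exists>w. embeds ar s S M w \<and> w (s - 1) = a \<and> w s = b)" (is "?L \<longleftrightarrow> ?R")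
  proof
    assume ?L
    then obtain w where w: "\<forall>x. x \<notin> set [1..<s - 1] \<longrightarrow> w x = (v(s - 1 := a, s := b)) x"
      "\<forall>x \<in> set [1..<s - 1]. w x \<in> universe M" "sat M w \<chi>"
      unfolding sat_foldr_Exists by blast
    have ws: "w (s - 1) = a" "w s = b" using w(1) s by auto
    then have "w ` {1..s} \<subseteq> universe M" unfolding set_eq using w(2) ab by auto
    then show ?R using sat_describes[OF d M _ S] w(3) ws by blast
  next
    assume ?R
    then obtain w where w: "embeds ar s S M w" "w (s - 1) = a" "w s = b" by blast
    \<comment> \<open>Outside \<open>{1..s}\<close> the assignment has to agree with
      \<open>v\<close> for \<open>sat_foldr_Exists\<close>; \<open>embeds\<close> does not see those
      values.\<close>
    define w' where "w' x = (if x \<in> {1..s} then w x else v x)" for x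
    have w's: "w' ` {1..s} = w ` {1..s}" by (auto simp: w'_def)
    have "map w' ys = map w ys" if "set ys \<subseteq> {1..s}" for ys
      using that by (auto simp: w'_def)
    moreover have "inj_on w' {1..s} \<longleftrightarrow> inj_on w {1..s}"
      by (rule inj_on_cong) (simp add: w'_def)
    ultimately have "embeds ar s S M w'" using w(1) unfolding embeds_def w's by metis
    then have "sat M w' \<chi>" using sat_describes[OF d M _ S] unfolding embeds_def by blast
    moreover have "\<forall>x. x \<notin> set [1..<s - 1] \<longrightarrow> w' x = (v(s - 1 := a, s := b)) x"
      using w s by (auto simp: w'_def)
    moreover have "\<forall>x \<in> set [1..<s - 1]. w' x \<in> universe M"
      using w(1) by (auto simp: w'_def embeds_def image_subset_iff)
    ultimately show ?L unfolding sat_foldr_Exists by blast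
  qed
  then show ?thesis using s by (auto simp: xi_def)
qed

subsection \<open>Counting and limits\<close>

text \<open>Independence in counting form: for a uniformly random subset \<open>X\<close> of
  \<open>T\<close> the traces on the disjoint windows \<open>D k\<close> are independent, and each
  equals its pattern \<open>P k\<close> with probability at least \<open>1 / 2 ^ d\<close>.\<close>

lemma card_avoid_patterns:
  fixes D P :: "'k \<Rightarrow> 'b set"
  assumes "finite K" "finite T"
    and "\<And>k. k \<in> K \<Longrightarrow> D k \<subseteq> T \<and> card (D k) \<le> d \<and> P k \<subseteq> D k"
    and "\<And>k k'. k \<in> K \<Longrightarrow> k' \<in> K \<Longrightarrow> k \<noteq> k' \<Longrightarrow> D k \<inter> D k' = {}"
  shows "real (card {X \<in> Pow T. \<forall>k \<in> K. X \<inter> D k \<noteq> P k}) \<le> (1 - 1 / 2 ^ d) ^ card K * 2 ^ card T"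
  using assms
proof (induction K arbitrary: T rule: finite_induct)
  case empty
  then show ?case using card_Pow[of T] by (simp add: Pow_def)
next
  case (insert k K)
  let ?T = "T - D k"
  let ?q = "1 - 1 / 2 ^ d :: real"
  have fin: "finite (D k)" "finite ?T" using insert.prems by (auto intro: finite_subset)
  have IH: "real (card {X \<in> Pow ?T. \<forall>k \<in> K. X \<inter> D k \<noteq> P k}) \<le> ?q ^ card K * 2 ^ card ?T"
  proof (rule insert.IH)
    fix k' assume k': "k' \<in> K"
    then have "D k \<inter> D k' = {}" using insert.prems(3)[of k k'] insert.hyps by blast
    then show "D k' \<subseteq> ?T \<and> card (D k') \<le> d \<and> P k' \<subseteq> D k'"
      using insert.prems(2)[of k'] k' by auto
  qed (use fin insert.prems in auto)
  let ?F = "{X \<in> Pow T. \<forall>k \<in> insert k K. X \<inter> D k \<noteq> P k}"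
  let ?G = "(Pow (D k) - {P k}) \<times> {X \<in> Pow ?T. \<forall>k \<in> K. X \<inter> D k \<noteq> P k}"
  \<comment> \<open>Splits off one window: its trace has one forbidden value, and the rest of
    \<open>X\<close> still avoids the other patterns because the windows are disjoint.\<close>
  let ?\<phi> = "\<lambda>X. (X \<inter> D k, X - D k)"
  have "inj_on ?\<phi> ?F" by (rule inj_onI) blast
  moreover have "?\<phi> ` ?F \<subseteq> ?G"
  proof -
    have "(X - D k) \<inter> D k' = X \<inter> D k'" if "k' \<in> K" for X k'
      using insert.prems(3)[of k k'] insert.hyps that by blast
    then show ?thesis by auto
  qed
  moreover have "finite ?G" using fin by auto
  ultimately have "card ?F \<le> card ?G" by (rule card_inj_on_le)
  also have "card ?G = (2 ^ card (D k) - 1) * card {X \<in> Pow ?T. \<forall>k \<in> K. X \<inter> D k \<noteq> P k}"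
    using insert.prems(2)[of k] fin by (simp add: card_cartesian_product card_Pow card_Diff_singleton)
  finally have "real (card ?F) \<le>
      real ((2 ^ card (D k) - 1) * card {X \<in> Pow ?T. \<forall>k \<in> K. X \<inter> D k \<noteq> P k})"
    by (rule of_nat_mono)
  also have "\<dots> = (2 ^ card (D k) - 1) * real (card {X \<in> Pow ?T. \<forall>k \<in> K. X \<inter> D k \<noteq> P k})"
    by (simp add: of_nat_diff)
  also have "\<dots> \<le> (2 ^ card (D k) - 1) * (?q ^ card K * 2 ^ card ?T)"
    using IH by (intro mult_left_mono) auto
  also have "\<dots> \<le> (?q * 2 ^ card (D k)) * (?q ^ card K * 2 ^ card ?T)"
  proof (rule mult_right_mono)
    have "(2::real) ^ card (D k) \<le> 2 ^ d" using insert.prems(2)[of k] by (intro power_increasing) auto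
    then show "2 ^ card (D k) - 1 \<le> ?q * 2 ^ card (D k)" by (simp add: field_simps)
  qed auto
  also have "\<dots> = ?q ^ card (insert k K) * (2 ^ (card (D k) + card ?T))"
    using insert.hyps by (simp add: power_add)
  also have "card (D k) + card ?T = card T"
    using insert.prems fin by (simp add: card_Diff_subset card_mono)
  finally show ?case .
qed


lemma proportion_le_1: "finite A \<Longrightarrow> proportion A P \<le> 1"
  unfolding proportion_def using card_mono[of A "{x \<in> A. P x}"]
  by (cases "card A = 0") (auto simp: divide_le_eq_1)

lemma proportion_mono:
  assumes "finite A" "\<And>x. x \<in> A \<Longrightarrow> P x \<Longrightarrow> Q x"
  shows "proportion A P \<le> proportion A Q"
  unfolding proportion_def using assms by (intro divide_right_mono of_nat_mono card_mono) auto

lemma eventually_ge_mult_ln: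
  fixes f :: "nat \<Rightarrow> real"
  assumes "filterlim (\<lambda>n. f n / ln (real n)) at_top sequentially"
  shows "eventually (\<lambda>n. 3 \<le> n \<and> 1 \<le> ln (real n) \<and> K * ln (real n) \<le> f n) sequentially"
proof -
  have "eventually (\<lambda>n. K \<le> f n / ln (real n)) sequentially"
    using assms by (simp add: filterlim_at_top)
  then show ?thesis using eventually_ge_at_top[of 3]
  proof eventually_elim
    case (elim n)
    have "exp 1 \<le> real n" using exp_le elim(2) by linarith
    then have "1 \<le> ln (real n)" using elim(2) by (simp add: ln_ge_iff)
    then show ?case using elim by (simp add: field_simps)
  qed
qed

text \<open>A union bound over a quadratic number of bad events, each of probability at most
  \<open>q ^ t\<close>: since \<open>f\<close> outgrows \<open>ln\<close>, eventually
  \<open>q ^ t\<close> is at most \<open>1 / n ^ 3\<close>. The exponent counts the disjoint blocks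
  of \<open>s\<close> vertices that fit into a class of size at least \<open>f n\<close> once two
  vertices are set aside.\<close>

lemma quadratic_times_power_tendsto_0:
  fixes f :: "nat \<Rightarrow> real" and q :: real and l s :: nat
  assumes q: "0 < q" "q < 1" and s: "0 < s"
    and f: "filterlim (\<lambda>n. f n / ln (real n)) at_top sequentially"
  shows "(\<lambda>n. real (n\<^sup>2 + l\<^sup>2) * q ^ ((nat \<lceil>f n\<rceil> - 2) div s)) \<longlonglongrightarrow> 0"
proof (rule tendsto_sandwich[OF _ _ tendsto_const])
  define c where "c = - ln q"
  have c: "0 < c" using q by (simp add: c_def)
  show "(\<lambda>n. real (1 + l\<^sup>2) / real n) \<longlonglongrightarrow> 0" by (rule lim_const_over_n)
  \<comment> \<open>In the factor \<open>3 + 3 / c\<close> the part \<open>3 / c\<close> yields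
    \<open>q ^ t \<le> 1 / n ^ 3\<close>; the other 3 pays for the rounding loss, as
    \<open>1 \<le> ln n\<close>.\<close>
  show "eventually (\<lambda>n. real (n\<^sup>2 + l\<^sup>2) * q ^ ((nat \<lceil>f n\<rceil> - 2) div s) \<le> real (1 + l\<^sup>2) / real n)
      sequentially"
    using eventually_ge_mult_ln[OF f, of "real s * (3 + 3 / c)"]
  proof eventually_elim
    case (elim n)
    define t where "t = (nat \<lceil>f n\<rceil> - 2) div s"
    have "nat \<lceil>f n\<rceil> - 2 < s * Suc t"
      unfolding t_def using s by (metis dividend_less_times_div mult_Suc_right add.commute)
    then have "nat \<lceil>f n\<rceil> < s * Suc t + 2" by linarith
    then have "real (nat \<lceil>f n\<rceil>) \<le> real (s * Suc t + 2)"
      by (rule of_nat_mono[OF less_imp_le])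
    also have "\<dots> = real s * (real t + 1) + 2" by (simp add: algebra_simps)
    finally have "f n \<le> real s * (real t + 1) + 2"
      by (rule order_trans[OF real_nat_ceiling_ge])
    also have "\<dots> \<le> real s * (real t + 3)" using s by (simp add: algebra_simps)
    finally have "real s * ((3 + 3 / c) * ln (real n)) \<le> real s * (real t + 3)"
      using elim by (simp add: mult_ac)
    then have "(3 + 3 / c) * ln (real n) \<le> real t + 3" using s by simp
    then have "3 / c * ln (real n) \<le> real t" using elim by (simp add: distrib_right)
    then have t: "3 * ln (real n) \<le> real t * c" using c by (simp add: field_simps)
    have "q ^ t = exp (- (real t * c))" unfolding c_def using q by (simp add: exp_of_nat_mult)
    also have "\<dots> \<le> exp (- (3 * ln (real n)))" using t by simp
    also have "\<dots> = 1 / real n ^ 3"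
      using elim by (simp add: exp_minus exp_of_nat_mult[of 3, simplified] inverse_eq_divide)
    finally have "real (n\<^sup>2 + l\<^sup>2) * q ^ t \<le> real (n\<^sup>2 + l\<^sup>2) * (1 / real n ^ 3)"
      by (intro mult_left_mono) auto
    also have "\<dots> \<le> real (n\<^sup>2 * (1 + l\<^sup>2)) * (1 / real n ^ 3)"
    proof (intro mult_right_mono of_nat_mono)
      have "1 * l\<^sup>2 \<le> n\<^sup>2 * l\<^sup>2" using elim by (intro mult_le_mono1) simp
      then show "n\<^sup>2 + l\<^sup>2 \<le> n\<^sup>2 * (1 + l\<^sup>2)" by (simp add: algebra_simps)
    qed simp
    also have "\<dots> = real (1 + l\<^sup>2) / real n"
      using elim by (simp add: power2_eq_square power3_eq_cube field_simps)
    finally show ?case by (simp add: t_def)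
  qed
qed (use q in auto)

text \<open>Pigeonhole: \<open>l\<close> classes of size at most \<open>w\<close> fill
  \<open>l * w\<close> elements only if none of them falls short.\<close>

lemma balanced_class_card:
  fixes \<gamma> :: "'a \<Rightarrow> nat"
  assumes A: "finite A" "card A = l * w" and \<gamma>: "\<gamma> ` A \<subseteq> {1..l}"
    and le: "\<And>c. card {a \<in> A. \<gamma> a = c} \<le> w" and c: "c \<in> {1..l}"
  shows "card {a \<in> A. \<gamma> a = c} = w"
proof (rule ccontr)
  assume "card {a \<in> A. \<gamma> a = c} \<noteq> w"
  then have "card {a \<in> A. \<gamma> a = c} < w" using le[of c] by simp
  then have "(\<Sum>i\<in>{1..l}. card {a \<in> A. \<gamma> a = i}) < (\<Sum>i\<in>{1..l}. w)"
    using le c by (intro sum_strict_mono_ex1) auto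
  moreover have "card A \<le> card (\<Union>i\<in>{1..l}. {a \<in> A. \<gamma> a = i})"
    using A(1) \<gamma> by (intro card_mono) auto
  moreover have "\<dots> \<le> (\<Sum>i\<in>{1..l}. card {a \<in> A. \<gamma> a = i})" by (intro card_UN_le) simp
  ultimately show False using A(2) by simp
qed

subsection \<open>Random structures with a prescribed colouring\<close>

text \<open>
  Both notions of colouring depend only on whether the list of colours of each tuple is acceptable,
  which \<open>ok\<close> expresses. The last assumption gives, for two colours \<open>i\<close> and \<open>j\<close>, a type of tuple
  whose presence prevents identifying \<open>i\<close> and \<open>j\<close>; for strong colourings it needs arities \<open>\<le> l\<close>.
\<close>

locale colour_notion =
  fixes ar :: "'r::finite \<Rightarrow> nat" and l :: nat and ok :: "nat list \<Rightarrow> bool"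
    and col :: "'r colouring_notion"
  assumes col_iff: "col l M \<gamma> \<longleftrightarrow>
      (\<forall>a \<in> universe M. \<gamma> a \<in> {1..l}) \<and> (\<forall>R. \<forall>xs \<in> interp M R. ok (map \<gamma> xs))"
    and ar_ge_2: "2 \<le> ar R"
    and not_ok_const: "2 \<le> length cs \<Longrightarrow> set cs \<subseteq> {c} \<Longrightarrow> \<not> ok cs"
    and separating: "i \<in> {1..l} \<Longrightarrow> j \<in> {1..l} \<Longrightarrow> i \<noteq> j \<Longrightarrow>
      \<exists>R cs. length cs = ar R \<and> set cs \<subseteq> {1..l} \<and> ok cs \<and>
        (\<forall>p. p i = p j \<longrightarrow> \<not> ok (map p cs))"
begin

section \<open>Coloured structures as subsets of the admissible tuples\<close>

definition coloured :: "nat \<Rightarrow> (nat \<Rightarrow> nat) \<Rightarrow> ('r, nat) rstruct set" where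
  "coloured n \<gamma> = {M. is_struct ar M \<and> universe M = {1..n} \<and> col l M \<gamma>}"

definition tuples :: "nat set \<Rightarrow> ('r \<times> nat list) set" where
  "tuples V = (SIGMA R:UNIV. {xs. set xs \<subseteq> V \<and> length xs = ar R})"

definition slots :: "nat \<Rightarrow> (nat \<Rightarrow> nat) \<Rightarrow> ('r \<times> nat list) set" where
  "slots n \<gamma> = {(R, xs) \<in> tuples {1..n}. ok (map \<gamma> xs)}"

definition struct_of :: "nat \<Rightarrow> ('r \<times> nat list) set \<Rightarrow> ('r, nat) rstruct" where
  "struct_of n X = \<lparr>universe = {1..n}, interp = (\<lambda>R. {xs. (R, xs) \<in> X})\<rparr>"

lemma finite_tuples: "finite V \<Longrightarrow> finite (tuples V)"
  unfolding tuples_def by (intro finite_SigmaI finite_lists_length_eq) auto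

lemma card_tuples: "finite V \<Longrightarrow> card (tuples V) = (\<Sum>R\<in>UNIV. card V ^ ar R)"
  unfolding tuples_def by (simp add: card_lists_length_eq finite_lists_length_eq)

lemma finite_slots: "finite (slots n \<gamma>)"
  by (rule finite_subset[OF _ finite_tuples[of "{1..n}"]]) (auto simp: slots_def)

lemma inj_struct_of: "inj (struct_of n)"
proof (rule injI)
  fix X Y assume "struct_of n X = struct_of n Y"
  then have "\<And>R. {xs. (R, xs) \<in> X} = {xs. (R, xs) \<in> Y}"
    unfolding struct_of_def by (metis rstruct.select_convs(2))
  then show "X = Y" by auto
qed

lemma struct_of_cover:
  assumes "is_struct ar M" "universe M = {1..n}"
  shows "\<exists>X \<subseteq> tuples {1..n}. M = struct_of n X"
proof (intro exI conjI)
  let ?X = "{(R, xs). xs \<in> interp M R}"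
  show "?X \<subseteq> tuples {1..n}" using assms by (auto simp: tuples_def is_struct_def)
  show "M = struct_of n ?X" using assms by (cases M) (simp add: struct_of_def)
qed

text \<open>A colouring is tested tuple by tuple, so any set of admissible tuples may be chosen; the
  uniform measure on \<open>coloured n \<gamma>\<close> is thus that of independent fair coins, one
  for each slot.\<close>

lemma coloured_eq:
  assumes "\<gamma> ` {1..n} \<subseteq> {1..l}"
  shows "coloured n \<gamma> = struct_of n ` Pow (slots n \<gamma>)"
proof
  show "coloured n \<gamma> \<subseteq> struct_of n ` Pow (slots n \<gamma>)"
  proof
    fix M assume M: "M \<in> coloured n \<gamma>"
    then obtain X where X: "X \<subseteq> tuples {1..n}" "M = struct_of n X"
      using struct_of_cover unfolding coloured_def by blast
    have "X \<subseteq> slots n \<gamma>" using M X by (auto simp: coloured_def slots_def col_iff struct_of_def)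
    then show "M \<in> struct_of n ` Pow (slots n \<gamma>)" using X by blast
  qed
  show "struct_of n ` Pow (slots n \<gamma>) \<subseteq> coloured n \<gamma>"
  proof
    fix M assume "M \<in> struct_of n ` Pow (slots n \<gamma>)"
    then obtain X where X: "X \<subseteq> slots n \<gamma>" "M = struct_of n X" by blast
    then have "length xs = ar R \<and> set xs \<subseteq> {1..n} \<and> ok (map \<gamma> xs)" if "xs \<in> interp M R" for R xs
      using that by (auto simp: slots_def tuples_def struct_of_def)
    moreover have "universe M = {1..n}" using X by (simp add: struct_of_def)
    ultimately show "M \<in> coloured n \<gamma>"
      using assms unfolding coloured_def is_struct_def col_iff by blast
  qed
qed

lemma card_coloured_Collect:
  assumes "\<gamma> ` {1..n} \<subseteq> {1..l}"
  shows "card {M \<in> coloured n \<gamma>. Q M} = card {X \<in> Pow (slots n \<gamma>). Q (struct_of n X)}"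
proof -
  have "{M \<in> coloured n \<gamma>. Q M} = struct_of n ` {X \<in> Pow (slots n \<gamma>). Q (struct_of n X)}"
    unfolding coloured_eq[OF assms] by auto
  then show ?thesis by (simp add: card_image inj_on_subset[OF inj_struct_of])
qed

lemma finite_coloured: "\<gamma> ` {1..n} \<subseteq> {1..l} \<Longrightarrow> finite (coloured n \<gamma>)"
  by (simp add: coloured_eq finite_slots)

lemma card_coloured: "\<gamma> ` {1..n} \<subseteq> {1..l} \<Longrightarrow> card (coloured n \<gamma>) = 2 ^ card (slots n \<gamma>)"
  using card_coloured_Collect[of \<gamma> n "\<lambda>_. True"] card_Pow[OF finite_slots, of n \<gamma>]
  by (simp add: Pow_def)

section \<open>Links and separations, and the chance that one is missing\<close>

definition linked :: "nat \<Rightarrow> ('r, nat) rstruct \<Rightarrow> ('r, nat) rstruct \<Rightarrow> nat \<Rightarrow> nat \<Rightarrow> bool" where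
  "linked s S M a b \<longleftrightarrow> (\<exists>w. embeds ar s S M w \<and> w (s - 1) = a \<and> w s = b)"

text \<open>Quantifying over all \<open>p\<close> lets a single tuple rule out every recolouring
  that merges \<open>i\<close> and \<open>j\<close>; the \<open>p\<close> to which this is applied
  depends on a second colouring, which is not known in advance.\<close>

definition separated :: "('r, nat) rstruct \<Rightarrow> (nat \<Rightarrow> nat) \<Rightarrow> nat \<Rightarrow> nat \<Rightarrow> bool" where
  "separated M \<gamma> i j \<longleftrightarrow>
     (\<exists>R. \<exists>xs \<in> interp M R. \<forall>p. p i = p j \<longrightarrow> \<not> ok (map p (map \<gamma> xs)))"

text \<open>A copy of \<open>S\<close> pulls a colouring of \<open>M\<close> back to a colouring of
  \<open>S\<close>, which must agree at \<open>s - 1\<close> and \<open>s\<close>.\<close>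

lemma linked_same_colour:
  assumes S: "forcing_struct ar col l s S" and "linked s S M a b" "col l M \<gamma>"
  shows "\<gamma> a = \<gamma> b"
proof -
  obtain w where w: "embeds ar s S M w" "w (s - 1) = a" "w s = b"
    using assms(2) by (auto simp: linked_def)
  have "col l S (\<gamma> \<circ> w)"
    unfolding col_iff
  proof (intro conjI allI ballI)
    fix x assume "x \<in> universe S"
    then have "x \<in> {1..s}" using S by (simp add: forcing_struct_def)
    then have "w x \<in> universe M" using w(1) unfolding embeds_def by blast
    then show "(\<gamma> \<circ> w) x \<in> {1..l}" using assms(3) by (simp add: col_iff)
  next
    fix R xs assume xs: "xs \<in> interp S R"
    then have "length xs = ar R \<and> set xs \<subseteq> {1..s}"
      using S unfolding forcing_struct_def is_struct_def by auto
    then have "map w xs \<in> interp M R" using w(1) xs by (simp add: embeds_def)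
    then have "ok (map \<gamma> (map w xs))" using assms(3) unfolding col_iff by blast
    then show "ok (map (\<gamma> \<circ> w) xs)" by simp
  qed
  then have "(\<gamma> \<circ> w) (s - 1) = (\<gamma> \<circ> w) s" using S unfolding forcing_struct_def by blast
  then show ?thesis using w by simp
qed

text \<open>Take a separating colour pattern \<open>cs\<close>, fix a representative of the right
  colour for each later entry and let only the first entry range over its colour class. This gives
  at least \<open>m\<close> different slots, and any one of them present in the structure separates
  \<open>i\<close> from \<open>j\<close>.\<close>

lemma card_not_separated:
  assumes \<gamma>: "\<gamma> ` {1..n} \<subseteq> {1..l}"
    and rich: "\<And>i. i \<in> {1..l} \<Longrightarrow> m \<le> card {a \<in> {1..n}. \<gamma> a = i}" and m: "1 \<le> m"
    and ij: "i \<in> {1..l}" "j \<in> {1..l}" "i \<noteq> j"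
  shows "real (card {M \<in> coloured n \<gamma>. \<not> separated M \<gamma> i j}) \<le> (1 / 2) ^ m * real (card (coloured n \<gamma>))"
proof -
  obtain R cs where cs: "length cs = ar R" "set cs \<subseteq> {1..l}" "ok cs"
    "\<And>p. p i = p j \<Longrightarrow> \<not> ok (map p cs)" using separating[OF ij] by blast
  have "\<exists>a. a \<in> {1..n} \<and> \<gamma> a = c" if "c \<in> {1..l}" for c
  proof -
    have "card {a \<in> {1..n}. \<gamma> a = c} \<noteq> 0" using rich[OF that] m by linarith
    then have "{a \<in> {1..n}. \<gamma> a = c} \<noteq> {}" by (metis card.empty)
    then show ?thesis by blast
  qed
  then obtain e where e: "\<And>c. c \<in> {1..l} \<Longrightarrow> e c \<in> {1..n} \<and> \<gamma> (e c) = c" by metis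
  obtain c cs' where ccs: "cs = c # cs'" using cs(1) ar_ge_2[of R] by (cases cs) auto
  let ?K = "{a \<in> {1..n}. \<gamma> a = c}"
  let ?D = "\<lambda>a. {(R, a # map e cs')}"
  have col: "map \<gamma> (a # map e cs') = cs" if "a \<in> ?K" for a
    using that cs(2) e unfolding ccs by (auto intro!: map_idI)
  have slot: "?D a \<subseteq> slots n \<gamma>" if "a \<in> ?K" for a
  proof -
    have "set (a # map e cs') \<subseteq> {1..n}" using that cs(2) e unfolding ccs by fastforce
    then show ?thesis using cs(1,3) col[OF that] unfolding slots_def tuples_def ccs by auto
  qed
  have "{X \<in> Pow (slots n \<gamma>). \<not> separated (struct_of n X) \<gamma> i j}
      \<subseteq> {X \<in> Pow (slots n \<gamma>). \<forall>a \<in> ?K. X \<inter> ?D a \<noteq> ?D a}"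
  proof safe
    fix X a assume a: "a \<in> {1..n}" "c = \<gamma> a" "X \<inter> {(R, a # map e cs')} = {(R, a # map e cs')}"
      and "\<not> separated (struct_of n X) \<gamma> i j"
    moreover have "a # map e cs' \<in> interp (struct_of n X) R" using a by (auto simp: struct_of_def)
    ultimately have "\<exists>p. p i = p j \<and> ok (map p (map \<gamma> (a # map e cs')))"
      unfolding separated_def by blast
    then show False using cs(4) col[of a] a by auto
  qed
  then have "card {M \<in> coloured n \<gamma>. \<not> separated M \<gamma> i j}
      \<le> card {X \<in> Pow (slots n \<gamma>). \<forall>a \<in> ?K. X \<inter> ?D a \<noteq> ?D a}"
    unfolding card_coloured_Collect[OF \<gamma>] by (intro card_mono) (simp add: finite_slots)
  also have "real \<dots> \<le> (1 - 1 / 2 ^ 1) ^ card ?K * 2 ^ card (slots n \<gamma>)"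
    using slot by (intro card_avoid_patterns) (auto simp: finite_slots)
  also have "(1 - 1 / 2 ^ 1 :: real) ^ card ?K \<le> (1 / 2) ^ m"
    using rich[of c] cs(2) ccs by (auto intro: power_decreasing)
  finally show ?thesis by (simp add: card_coloured[OF \<gamma>])
qed

text \<open>Lays out \<open>t\<close> candidate copies of \<open>S\<close> that share only
  \<open>a\<close> and \<open>b\<close>, with \<open>\<gamma>\<close> colouring each as some
  colouring of \<open>S\<close> does. All tuples of \<open>S\<close> then land on slots, and
  \<open>card_avoid_patterns\<close> applies to the slots inside the copies.\<close>

lemma card_not_linked:
  assumes S: "forcing_struct ar col l s S"
    and \<gamma>: "\<gamma> ` {1..n} \<subseteq> {1..l}"
    and rich: "\<And>i. i \<in> {1..l} \<Longrightarrow> m \<le> card {a \<in> {1..n}. \<gamma> a = i}"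
    and t: "t * s + 2 \<le> m"
    and ab: "a \<in> {1..n}" "b \<in> {1..n}" "a \<noteq> b" "\<gamma> a = \<gamma> b"
    and d: "d = card (tuples {1..s})"
  shows "real (card {M \<in> coloured n \<gamma>. \<not> linked s S M a b})
      \<le> (1 - 1 / 2 ^ d) ^ t * real (card (coloured n \<gamma>))"
proof -
  have s: "3 \<le> s" and strS: "is_struct ar S" and US: "universe S = {1..s}"
    using S by (auto simp: forcing_struct_def)
  have "\<gamma> a \<in> {1..l}" using \<gamma> ab(1) by blast
  \<comment> \<open>\<open>S\<close> has a colouring with any prescribed colour at
    \<open>s - 1\<close> and \<open>s\<close>; the common colour of \<open>a\<close> and
    \<open>b\<close> is chosen.\<close>
  then obtain \<delta> where \<delta>: "col l S \<delta>" "\<delta> (s - 1) = \<gamma> a" "\<delta> s = \<gamma> b"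
    using S ab(4) unfolding forcing_struct_def by metis
  have \<delta>l: "\<delta> j \<in> {1..l}" if "j \<in> {1..s}" for j using \<delta>(1) that US by (simp add: col_iff)
  \<comment> \<open>Reserves \<open>t * s\<close> vertices of every colour, enough even if all
    copies used one colour throughout; keeping \<open>a\<close> and \<open>b\<close> out costs the 2
    in \<open>t * s + 2\<close>.\<close>
  have "\<exists>e. inj_on e {..<t * s} \<and> e ` {..<t * s} \<subseteq> {x \<in> {1..n}. \<gamma> x = i} - {a, b}" if "i \<in> {1..l}" for i
  proof -
    have "card {x \<in> {1..n}. \<gamma> x = i} - card {a, b} \<le> card ({x \<in> {1..n}. \<gamma> x = i} - {a, b})"
      by (rule diff_card_le_card_Diff) simp
    then have "card {..<t * s} \<le> card ({x \<in> {1..n}. \<gamma> x = i} - {a, b})"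
      using rich[OF that] t ab(3) by simp
    from card_le_inj[OF _ _ this] show ?thesis by auto
  qed
  then obtain e where e: "\<And>i. i \<in> {1..l} \<Longrightarrow> inj_on (e i) {..<t * s}"
    "\<And>i. i \<in> {1..l} \<Longrightarrow> e i ` {..<t * s} \<subseteq> {x \<in> {1..n}. \<gamma> x = i} - {a, b}" by metis
  have idx: "k * s + j < t * s" if "k < t" "j < s" for k j
  proof -
    have "k * s + j < Suc k * s" using that by simp
    also have "\<dots> \<le> t * s" using that by (intro mult_le_mono1) simp
    finally show ?thesis .
  qed
  \<comment> \<open>Position \<open>j\<close> of copy \<open>k\<close> takes vertex number
    \<open>k * s + j\<close> from the reserve of colour \<open>\<delta> j\<close>; since
    \<open>j < s\<close> at inner positions, these numbers determine \<open>k\<close> and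
    \<open>j\<close>.\<close>
  define w where "w k j = (if j = s then b else if j = s - 1 then a else e (\<delta> j) (k * s + j))" for k j
  have ws: "w k s = b" "w k (s - 1) = a" for k using s by (auto simp: w_def)
  have inner: "w k j \<in> {1..n} - {a, b} \<and> \<gamma> (w k j) = \<delta> j" if "k < t" "j \<in> {1..s}" "j \<noteq> s - 1" "j \<noteq> s" for k j
  proof -
    have "e (\<delta> j) (k * s + j) \<in> {x \<in> {1..n}. \<gamma> x = \<delta> j} - {a, b}"
      using e(2)[OF \<delta>l[OF that(2)]] idx[OF that(1), of j] that by auto
    then show ?thesis using that by (auto simp: w_def)
  qed
  have w_n: "w k j \<in> {1..n}" and w_col: "\<gamma> (w k j) = \<delta> j" if kj: "k < t" "j \<in> {1..s}" for k j
  proof -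
    consider "j = s - 1" | "j = s" | "j \<noteq> s - 1" "j \<noteq> s" by blast
    then have "w k j \<in> {1..n} \<and> \<gamma> (w k j) = \<delta> j"
    proof cases
      case 1
      then show ?thesis unfolding 1 ws using ab(1) \<delta>(2) by simp
    next
      case 2
      then show ?thesis unfolding 2 ws using ab(2) \<delta>(3) by simp
    next
      case 3
      then show ?thesis using inner[OF kj 3] by blast
    qed
    then show "w k j \<in> {1..n}" "\<gamma> (w k j) = \<delta> j" by blast+
  qed
  have w_eq: "(k = k' \<and> j = j') \<or> w k j \<in> {a, b} \<and> j = j'"
    if "k < t" "k' < t" "j \<in> {1..s}" "j' \<in> {1..s}" "w k j = w k' j'" for k k' j j'
  proof (cases "j \<in> {s - 1, s} \<or> j' \<in> {s - 1, s}")
    case True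
    then have "w k j \<in> {a, b}" using ws that(5) by auto
    then have "j \<in> {s - 1, s}" "j' \<in> {s - 1, s}"
      using inner[OF that(1,3)] inner[OF that(2,4)] that(5) by auto
    then have "j = j'" using ws that(5) ab(3) by auto
    then show ?thesis using \<open>w k j \<in> {a, b}\<close> by blast
  next
    case False
    have "\<delta> j = \<delta> j'" using w_col that by metis
    then have "e (\<delta> j) (k * s + j) = e (\<delta> j) (k' * s + j')"
      using that(5) False by (simp add: w_def)
    moreover have jj: "j < s" "j' < s" using False that by auto
    ultimately have eq: "k * s + j = k' * s + j'"
      using inj_onD[OF e(1)[OF \<delta>l[OF that(3)]]] idx that by simp
    have "j = j'" using arg_cong[OF eq, of "\<lambda>x. x mod s"] jj by simp
    then have "k = k'" using eq s by simp
    then show ?thesis using \<open>j = j'\<close> by blast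
  qed
  have w_inj: "inj_on (w k) {1..s}" if "k < t" for k
    using w_eq[OF that that] by (intro inj_onI) blast
  have meet: "w k ` {1..s} \<inter> w k' ` {1..s} \<subseteq> {a, b}" if "k < t" "k' < t" "k \<noteq> k'" for k k'
    using w_eq[OF that(1,2)] that(3) by blast
  \<comment> \<open>The window consists of all slots on the vertices of the copy, not only of the
    images of tuples of \<open>S\<close>: matching the pattern on all of it also excludes surplus
    tuples, as an induced copy requires.\<close>
  let ?D = "\<lambda>k. slots n \<gamma> \<inter> tuples (w k ` {1..s})"
  let ?P = "\<lambda>k. {(R, map (w k) ys) | R ys. ys \<in> interp S R}"
  have Sys: "length ys = ar R \<and> set ys \<subseteq> {1..s} \<and> ok (map \<delta> ys)" if "ys \<in> interp S R" for R ys
    using strS US \<delta>(1) that unfolding is_struct_def col_iff by auto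
  have map_col: "map \<gamma> (map (w k) ys) = map \<delta> ys" if "k < t" "set ys \<subseteq> {1..s}" for k ys
    using w_col[OF that(1)] that(2) by auto
  have DP: "?D k \<subseteq> slots n \<gamma> \<and> card (?D k) \<le> d \<and> ?P k \<subseteq> ?D k" if k: "k \<in> {..<t}" for k
  proof (intro conjI)
    have "card (?D k) \<le> card (tuples (w k ` {1..s}))"
      by (intro card_mono finite_tuples) auto
    also have "\<dots> = d" using w_inj k by (simp add: card_tuples card_image d)
    finally show "card (?D k) \<le> d" .
    show "?P k \<subseteq> ?D k"
    proof safe
      fix R ys assume "ys \<in> interp S R"
      note ys = Sys[OF this]
      show "(R, map (w k) ys) \<in> tuples (w k ` {1..s})" using ys by (auto simp: tuples_def)
      have "set (map (w k) ys) \<subseteq> {1..n}" using ys w_n k by fastforce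
      then show "(R, map (w k) ys) \<in> slots n \<gamma>"
        using ys map_col[of k ys] k by (simp add: slots_def tuples_def del: map_map)
    qed
  qed auto
  \<comment> \<open>A common tuple would have all entries in \<open>{a, b}\<close>, hence be monochromatic.\<close>
  have disj: "?D k \<inter> ?D k' = {}" if "k \<in> {..<t}" "k' \<in> {..<t}" "k \<noteq> k'" for k k'
  proof (rule ccontr)
    assume "?D k \<inter> ?D k' \<noteq> {}"
    then obtain R xs where xs: "(R, xs) \<in> slots n \<gamma>" "(R, xs) \<in> tuples (w k ` {1..s})"
      "(R, xs) \<in> tuples (w k' ` {1..s})" by auto
    have "set xs \<subseteq> w k ` {1..s} \<inter> w k' ` {1..s}" using xs(2,3) by (auto simp: tuples_def)
    also have "\<dots> \<subseteq> {a, b}" using meet that by simp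
    finally have "set (map \<gamma> xs) \<subseteq> {\<gamma> a}" using ab(4) by auto
    moreover have "2 \<le> length (map \<gamma> xs)" using xs(2) ar_ge_2[of R] by (auto simp: tuples_def)
    ultimately have "\<not> ok (map \<gamma> xs)" using not_ok_const by blast
    then show False using xs(1) by (simp add: slots_def)
  qed
  have "{X \<in> Pow (slots n \<gamma>). \<not> linked s S (struct_of n X) a b}
      \<subseteq> {X \<in> Pow (slots n \<gamma>). \<forall>k \<in> {..<t}. X \<inter> ?D k \<noteq> ?P k}"
  proof safe
    fix X k assume X: "X \<subseteq> slots n \<gamma>" and nl: "\<not> linked s S (struct_of n X) a b"
      and k: "k < t" and eq: "X \<inter> ?D k = ?P k"
    have "map (w k) ys \<in> interp (struct_of n X) R \<longleftrightarrow> ys \<in> interp S R"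
      if ys: "length ys = ar R" "set ys \<subseteq> {1..s}" for R ys
    proof -
      \<comment> \<open>\<open>X\<close> consists of slots only, so on the vertices of the copy
        membership in \<open>X\<close> is membership in its trace on the window.\<close>
      have "(R, map (w k) ys) \<in> X \<longleftrightarrow> (R, map (w k) ys) \<in> ?P k"
        using X ys eq[symmetric] by (auto simp: tuples_def)
      also have "\<dots> \<longleftrightarrow> ys \<in> interp S R"
      proof
        assume "(R, map (w k) ys) \<in> ?P k"
        then obtain ys' where ys': "map (w k) ys = map (w k) ys'" "ys' \<in> interp S R" by auto
        have "inj_on (w k) (set ys \<union> set ys')"
          using w_inj[OF k] Sys[OF ys'(2)] ys(2) by (meson inj_on_subset Un_least)
        then have "ys = ys'" using ys'(1) by (simp add: inj_on_map_eq_map)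
        then show "ys \<in> interp S R" using ys' by simp
      qed auto
      finally show ?thesis by (simp add: struct_of_def)
    qed
    then have "embeds ar s S (struct_of n X) (w k)"
      using w_inj[OF k] w_n[OF k] by (auto simp: embeds_def struct_of_def)
    then show False using nl ws unfolding linked_def by blast
  qed
  then have "card {M \<in> coloured n \<gamma>. \<not> linked s S M a b}
      \<le> card {X \<in> Pow (slots n \<gamma>). \<forall>k \<in> {..<t}. X \<inter> ?D k \<noteq> ?P k}"
    unfolding card_coloured_Collect[OF \<gamma>] by (intro card_mono) (simp add: finite_slots)
  also have "real \<dots> \<le> (1 - 1 / 2 ^ d) ^ card {..<t} * 2 ^ card (slots n \<gamma>)"
    using DP disj by (intro card_avoid_patterns finite_slots finite_lessThan) blast+
  finally show ?thesis by (simp add: card_coloured[OF \<gamma>])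
qed


subsection \<open>Good colourings\<close>

definition good :: "nat \<Rightarrow> ('r, nat) rstruct \<Rightarrow> ('r, nat) rstruct \<Rightarrow> (nat \<Rightarrow> nat) \<Rightarrow> bool" where
  "good s S M \<gamma> \<longleftrightarrow>
     (\<forall>a \<in> universe M. \<forall>b \<in> universe M. a \<noteq> b \<and> \<gamma> a = \<gamma> b \<longrightarrow> linked s S M a b) \<and>
     (\<forall>i \<in> {1..l}. \<forall>j \<in> {1..l}. i \<noteq> j \<longrightarrow> separated M \<gamma> i j) \<and>
     {1..l} \<subseteq> \<gamma> ` universe M"

text \<open>Links make \<open>\<gamma>'\<close> constant on the classes of \<open>\<gamma>\<close>,
  so it factors as \<open>p\<close> after \<open>\<gamma>\<close>. Separations keep \<open>p\<close>
  from merging two colours, and since every colour occurs, \<open>p\<close> is an injective map of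
  the finite set \<open>{1..l}\<close> into itself.\<close>

lemma good_factorization:
  assumes S: "forcing_struct ar col l s S" and M: "is_struct ar M"
    and g: "good s S M \<gamma>" and c: "col l M \<gamma>" "col l M \<gamma>'"
  obtains p where "bij_betw p {1..l} {1..l}" "\<And>a. a \<in> universe M \<Longrightarrow> \<gamma>' a = p (\<gamma> a)"
proof -
  define p where "p i = \<gamma>' (SOME a. a \<in> universe M \<and> \<gamma> a = i)" for i
  have rep: "(SOME b. b \<in> universe M \<and> \<gamma> b = \<gamma> a) \<in> universe M \<and>
      \<gamma> (SOME b. b \<in> universe M \<and> \<gamma> b = \<gamma> a) = \<gamma> a" if "a \<in> universe M" for a
    using someI[of "\<lambda>b. b \<in> universe M \<and> \<gamma> b = \<gamma> a" a] that by blast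
  have p: "\<gamma>' a = p (\<gamma> a)" if a: "a \<in> universe M" for a
  proof (cases "a = (SOME b. b \<in> universe M \<and> \<gamma> b = \<gamma> a)")
    case True
    then show ?thesis by (simp add: p_def)
  next
    case False
    then have "linked s S M a (SOME b. b \<in> universe M \<and> \<gamma> b = \<gamma> a)"
      using g rep[OF a] a unfolding good_def by metis
    then show ?thesis using linked_same_colour[OF S _ c(2)] by (simp add: p_def)
  qed
  have "inj_on p {1..l}"
  proof (rule inj_onI, rule ccontr)
    fix i j assume ij: "i \<in> {1..l}" "j \<in> {1..l}" "p i = p j" "i \<noteq> j"
    then obtain R xs where xs: "xs \<in> interp M R" "\<not> ok (map p (map \<gamma> xs))"
      using g unfolding good_def separated_def by blast
    have "set xs \<subseteq> universe M" using M xs(1) by (auto simp: is_struct_def)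
    then have "map \<gamma>' xs = map p (map \<gamma> xs)" using p by auto
    then show False using xs c(2) unfolding col_iff by metis
  qed
  moreover have "p ` {1..l} \<subseteq> {1..l}"
  proof
    fix y assume "y \<in> p ` {1..l}"
    then obtain a where "a \<in> universe M" "y = p (\<gamma> a)" using g unfolding good_def by blast
    then show "y \<in> {1..l}" using p[of a] c(2) unfolding col_iff by auto
  qed
  ultimately have "bij_betw p {1..l} {1..l}" by (simp add: bij_betw_def endo_inj_surj)
  then show thesis using p that by blast
qed

lemma good_unique_colouring:
  assumes S: "forcing_struct ar col l s S" and M: "is_struct ar M"
    and g: "good s S M \<gamma>" and c: "col l M \<gamma>"
  shows "unique_colouring col l M"
  unfolding unique_colouring_def
proof (intro conjI allI impI)
  show "\<exists>\<gamma>. col l M \<gamma>" using c by blast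
  fix \<gamma>1 \<gamma>2 assume c12: "col l M \<gamma>1 \<and> col l M \<gamma>2"
  obtain p1 where p1: "bij_betw p1 {1..l} {1..l}" "\<And>a. a \<in> universe M \<Longrightarrow> \<gamma>1 a = p1 (\<gamma> a)"
    using good_factorization[OF S M g c] c12 by metis
  obtain p2 where p2: "bij_betw p2 {1..l} {1..l}" "\<And>a. a \<in> universe M \<Longrightarrow> \<gamma>2 a = p2 (\<gamma> a)"
    using good_factorization[OF S M g c] c12 by metis
  have "\<gamma>2 a = (p2 \<circ> inv_into {1..l} p1) (\<gamma>1 a)" if "a \<in> universe M" for a
  proof -
    have "\<gamma> a \<in> {1..l}" using c that by (simp add: col_iff)
    then have "inv_into {1..l} p1 (\<gamma>1 a) = \<gamma> a"
      using p1 that by (simp add: bij_betw_inv_into_left)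
    then show ?thesis using p2(2) that by simp
  qed
  moreover have "bij_betw (p2 \<circ> inv_into {1..l} p1) {1..l} {1..l}"
    using bij_betw_trans[OF bij_betw_inv_into[OF p1(1)] p2(1)] .
  ultimately show "\<exists>p. bij_betw p {1..l} {1..l} \<and> (\<forall>a \<in> universe M. \<gamma>2 a = p (\<gamma>1 a))"
    by blast
qed

text \<open>One good colouring serves all others: the factor \<open>p\<close> is injective, so
  \<open>\<gamma>'\<close> has the same classes as \<open>\<gamma>\<close>.\<close>

lemma good_definable:
  assumes S: "forcing_struct ar col l s S" and d: "describes ar s S \<chi>" and M: "is_struct ar M"
    and g: "good s S M \<gamma>" and c: "col l M \<gamma>" "col l M \<gamma>'"
  shows "definable_by (xi s \<chi>) (s - 1) s M \<gamma>'"
  unfolding definable_by_def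
proof (intro ballI allI)
  fix a b v assume ab: "a \<in> universe M" "b \<in> universe M"
  obtain p where p: "bij_betw p {1..l} {1..l}" "\<And>a. a \<in> universe M \<Longrightarrow> \<gamma>' a = p (\<gamma> a)"
    using good_factorization[OF S M g c] by metis
  have "sat M (v(s - 1 := a, s := b)) (xi s \<chi>) \<longleftrightarrow> a = b \<or> linked s S M a b"
    using sat_xi[OF d M _ _ ab] S by (simp add: forcing_struct_def linked_def)
  also have "\<dots> \<longleftrightarrow> \<gamma>' a = \<gamma>' b"
  proof
    assume "a = b \<or> linked s S M a b"
    then show "\<gamma>' a = \<gamma>' b" using linked_same_colour[OF S _ c(2)] by blast
  next
    assume eq: "\<gamma>' a = \<gamma>' b"
    have "\<gamma> a \<in> {1..l}" "\<gamma> b \<in> {1..l}" using c(1) ab by (simp_all add: col_iff)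
    then have "\<gamma> a = \<gamma> b"
      using eq p(2)[OF ab(1)] p(2)[OF ab(2)] bij_betw_imp_inj_on[OF p(1)] by (simp add: inj_on_eq_iff)
    then show "a = b \<or> linked s S M a b" using g ab by (auto simp: good_def)
  qed
  finally show "sat M (v(s - 1 := a, s := b)) (xi s \<chi>) \<longleftrightarrow> \<gamma>' a = \<gamma>' b" .
qed

text \<open>Union bound over at most \<open>n\<^sup>2\<close> pairs of vertices and
  \<open>l\<^sup>2\<close> pairs of colours. Surjectivity costs nothing, since richness makes every
  class nonempty.\<close>

lemma card_not_good:
  assumes S: "forcing_struct ar col l s S"
    and \<gamma>: "\<gamma> ` {1..n} \<subseteq> {1..l}"
    and rich: "\<And>i. i \<in> {1..l} \<Longrightarrow> m \<le> card {a \<in> {1..n}. \<gamma> a = i}"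
    and t: "t * s + 2 \<le> m"
    and d: "d = Suc (card (tuples {1..s}))"
  shows "real (card {M \<in> coloured n \<gamma>. \<not> good s S M \<gamma>})
      \<le> real (n\<^sup>2 + l\<^sup>2) * (1 - 1 / 2 ^ d) ^ t * real (card (coloured n \<gamma>))"
proof -
  let ?q = "1 - 1 / 2 ^ d :: real"
  let ?A = "coloured n \<gamma>"
  let ?E = "{(a, b) \<in> {1..n} \<times> {1..n}. a \<noteq> b \<and> \<gamma> a = \<gamma> b}"
  let ?I = "{(i, j) \<in> {1..l} \<times> {1..l}. i \<noteq> j}"
  let ?L = "\<lambda>(a, b). {M \<in> ?A. \<not> linked s S M a b}"
  let ?S = "\<lambda>(i, j). {M \<in> ?A. \<not> separated M \<gamma> i j}"
  let ?r = "?q ^ t * real (card ?A)"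
  have fin: "finite ?A" by (rule finite_coloured[OF \<gamma>])
  have finE: "finite ?E" and finI: "finite ?I" by (rule finite_subset[of _ "{1..n} \<times> {1..n}"]; auto)
     (rule finite_subset[of _ "{1..l} \<times> {1..l}"]; auto)
  have onto: "{1..l} \<subseteq> \<gamma> ` {1..n}"
  proof
    fix i assume "i \<in> {1..l}"
    then have "card {a \<in> {1..n}. \<gamma> a = i} \<noteq> 0" using rich[of i] t by linarith
    then have "{a \<in> {1..n}. \<gamma> a = i} \<noteq> {}" by (metis card.empty)
    then show "i \<in> \<gamma> ` {1..n}" by blast
  qed
  have L: "real (card (?L e)) \<le> ?r" if "e \<in> ?E" for e
  proof (cases e)
    case (Pair a b)
    then have e: "e = (a, b)" "a \<in> {1..n}" "b \<in> {1..n}" "a \<noteq> b" "\<gamma> a = \<gamma> b" using that by auto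
    have "real (card (?L e)) \<le> (1 - 1 / 2 ^ card (tuples {1..s})) ^ t * real (card ?A)"
      using card_not_linked[OF S \<gamma> rich t e(2-5) refl] e(1) by simp
    also have "\<dots> \<le> ?r"
      unfolding d by (intro mult_right_mono power_mono) (auto simp: field_simps)
    finally show ?thesis .
  qed
  have tm: "t \<le> m"
  proof -
    have "t * 1 \<le> t * s" using S by (intro mult_le_mono2) (simp add: forcing_struct_def)
    then show ?thesis using t by linarith
  qed
  have Sep: "real (card (?S e)) \<le> ?r" if "e \<in> ?I" for e
  proof (cases e)
    case (Pair i j)
    then have e: "e = (i, j)" "i \<in> {1..l}" "j \<in> {1..l}" "i \<noteq> j" using that by auto
    have "real (card (?S e)) \<le> (1 / 2) ^ m * real (card ?A)"
      using card_not_separated[OF \<gamma> rich _ e(2-4)] t e(1) by simp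
    also have "\<dots> \<le> (1 / 2) ^ t * real (card ?A)"
      using tm by (intro mult_right_mono power_decreasing) auto
    \<comment> \<open>The successor in \<open>d\<close> ensures
      \<open>1 / 2 \<le> 1 - 1 / 2 ^ d\<close>, so one rate covers missing separations as well as
      missing links.\<close>
    also have "\<dots> \<le> ?r"
      unfolding d by (intro mult_right_mono power_mono) (auto simp: field_simps)
    finally show ?thesis .
  qed
  have q0: "0 \<le> ?q" by simp
  have r0: "0 \<le> ?r" using q0 by (intro mult_nonneg_nonneg zero_le_power) auto
  have "{M \<in> ?A. \<not> good s S M \<gamma>} \<subseteq> (\<Union>e\<in>?E. ?L e) \<union> (\<Union>e\<in>?I. ?S e)"
  proof
    fix M assume M: "M \<in> {M \<in> ?A. \<not> good s S M \<gamma>}"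
    then have U: "universe M = {1..n}" and ng: "\<not> good s S M \<gamma>" by (simp_all add: coloured_def)
    have "(\<exists>a\<in>{1..n}. \<exists>b\<in>{1..n}. a \<noteq> b \<and> \<gamma> a = \<gamma> b \<and> \<not> linked s S M a b) \<or>
        (\<exists>i\<in>{1..l}. \<exists>j\<in>{1..l}. i \<noteq> j \<and> \<not> separated M \<gamma> i j)"
      using ng onto unfolding good_def U by simp
    then show "M \<in> (\<Union>e\<in>?E. ?L e) \<union> (\<Union>e\<in>?I. ?S e)"
    proof (elim disjE bexE conjE)
      fix a b assume "a \<in> {1..n}" "b \<in> {1..n}" "a \<noteq> b" "\<gamma> a = \<gamma> b" "\<not> linked s S M a b"
      then have "(a, b) \<in> ?E" "M \<in> ?L (a, b)" using M by simp_all
      then show ?thesis by (intro UnI1 UN_I)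
    next
      fix i j assume "i \<in> {1..l}" "j \<in> {1..l}" "i \<noteq> j" "\<not> separated M \<gamma> i j"
      then have "(i, j) \<in> ?I" "M \<in> ?S (i, j)" using M by simp_all
      then show ?thesis by (intro UnI2 UN_I)
    qed
  qed
  then have "card {M \<in> ?A. \<not> good s S M \<gamma>} \<le> card ((\<Union>e\<in>?E. ?L e) \<union> (\<Union>e\<in>?I. ?S e))"
    using fin finE finI by (intro card_mono) auto
  also have "\<dots> \<le> card (\<Union>e\<in>?E. ?L e) + card (\<Union>e\<in>?I. ?S e)" by (rule card_Un_le)
  also have "\<dots> \<le> (\<Sum>e\<in>?E. card (?L e)) + (\<Sum>e\<in>?I. card (?S e))"
    by (intro add_mono card_UN_le finE finI)
  finally have "real (card {M \<in> ?A. \<not> good s S M \<gamma>})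
      \<le> real ((\<Sum>e\<in>?E. card (?L e)) + (\<Sum>e\<in>?I. card (?S e)))" by (rule of_nat_mono)
  also have "\<dots> = (\<Sum>e\<in>?E. real (card (?L e))) + (\<Sum>e\<in>?I. real (card (?S e)))" by simp
  also have "\<dots> \<le> real (card ?E) * ?r + real (card ?I) * ?r"
    using L Sep by (intro add_mono sum_bounded_above) auto
  also have "\<dots> \<le> real (n\<^sup>2) * ?r + real (l\<^sup>2) * ?r"
  proof (intro add_mono mult_right_mono r0 of_nat_mono)
    have "card ?E \<le> card ({1..n} \<times> {1..n})" by (intro card_mono) auto
    then show "card ?E \<le> n\<^sup>2" by (simp add: card_cartesian_product power2_eq_square)
    have "card ?I \<le> card ({1..l} \<times> {1..l})" by (intro card_mono) auto
    then show "card ?I \<le> l\<^sup>2" by (simp add: card_cartesian_product power2_eq_square)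
  qed
  finally show ?thesis by (simp add: algebra_simps)
qed

section \<open>Double counting of structures and rich colourings\<close>

lemma finite_colourables: "finite (colourables ar col l n)"
proof (rule finite_subset)
  show "colourables ar col l n \<subseteq> struct_of n ` Pow (tuples {1..n})"
    using struct_of_cover unfolding colourables_def by blast
qed (simp add: finite_tuples)

text \<open>Counts pairs of a structure and a rich colouring of it: \<open>N\<close> in all,
  \<open>G\<close> good and \<open>B\<close> bad ones. The bad share is at most
  \<open>\<epsilon>\<close>, and \<open>G\<close> is at most \<open>l ^ l\<close> times the number
  of structures. Every structure with a rich but no good colouring accounts for a bad pair.\<close>

lemma proportion_good_ge:
  assumes S: "forcing_struct ar col l s S"
    and t: "t * s + 2 \<le> nat \<lceil>x\<rceil>"
    and d: "d = Suc (card (tuples {1..s}))"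
    and \<epsilon>: "\<epsilon> = real (n\<^sup>2 + l\<^sup>2) * (1 - 1 / 2 ^ d) ^ t" "\<epsilon> \<le> 1 / 2"
  shows "proportion (colourables ar col l n) (\<lambda>M. \<exists>\<gamma>. col l M \<gamma> \<and> rich l x M \<gamma>) - 2 * \<epsilon> * real (l ^ l)
    \<le> proportion (colourables ar col l n) (\<lambda>M. \<exists>\<gamma>. col l M \<gamma> \<and> good s S M \<gamma>)"
proof -
  let ?C = "colourables ar col l n"
  \<comment> \<open>Extensional functions, so that every colouring of \<open>{1..n}\<close> is
    counted once; the ceiling is harmless because class sizes are integers.\<close>
  define \<Gamma> where "\<Gamma> = {\<gamma> \<in> {1..n} \<rightarrow>\<^sub>E {1..l}. \<forall>i \<in> {1..l}. nat \<lceil>x\<rceil> \<le> card {a \<in> {1..n}. \<gamma> a = i}}"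
  define N where "N = (\<Sum>\<gamma>\<in>\<Gamma>. card (coloured n \<gamma>))"
  define B where "B = (\<Sum>\<gamma>\<in>\<Gamma>. card {M \<in> coloured n \<gamma>. \<not> good s S M \<gamma>})"
  define G where "G = (\<Sum>\<gamma>\<in>\<Gamma>. card {M \<in> coloured n \<gamma>. good s S M \<gamma>})"
  define F where "F = {M \<in> ?C. \<exists>\<gamma>. col l M \<gamma> \<and> good s S M \<gamma>}"
  define H where "H = {M \<in> ?C. \<exists>\<gamma>. col l M \<gamma> \<and> rich l x M \<gamma>}"
  have fin\<Gamma>: "finite \<Gamma>" unfolding \<Gamma>_def by (simp add: finite_PiE)
  have finC: "finite ?C" by (rule finite_colourables)
  have \<Gamma>l: "\<gamma> ` {1..n} \<subseteq> {1..l}" if "\<gamma> \<in> \<Gamma>" for \<gamma> using that unfolding \<Gamma>_def by auto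
  have \<epsilon>0: "0 \<le> \<epsilon>" unfolding \<epsilon>(1) by (intro mult_nonneg_nonneg zero_le_power) auto
  have NGB: "N = G + B"
  proof -
    have "card (coloured n \<gamma>) = card {M \<in> coloured n \<gamma>. good s S M \<gamma>}
        + card {M \<in> coloured n \<gamma>. \<not> good s S M \<gamma>}" if "\<gamma> \<in> \<Gamma>" for \<gamma>
      using finite_coloured[OF \<Gamma>l[OF that]]
      by (subst card_Un_disjoint[symmetric]) (auto intro: arg_cong[where f = card])
    then show ?thesis unfolding N_def G_def B_def sum.distrib[symmetric] by (intro sum.cong) auto
  qed
  have B: "real B \<le> \<epsilon> * real N"
  proof -
    have "real (card {M \<in> coloured n \<gamma>. \<not> good s S M \<gamma>}) \<le> \<epsilon> * real (card (coloured n \<gamma>))"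
      if "\<gamma> \<in> \<Gamma>" for \<gamma>
      unfolding \<epsilon>(1) using that by (intro card_not_good[OF S \<Gamma>l[OF that] _ t d]) (simp add: \<Gamma>_def)
    then show ?thesis unfolding B_def N_def of_nat_sum sum_distrib_left by (intro sum_mono)
  qed
  have "G \<le> l ^ l * card F"
  proof -
    have "G = (\<Sum>\<gamma>\<in>\<Gamma>. card {M \<in> F. M \<in> coloured n \<gamma> \<and> good s S M \<gamma>})"
      unfolding G_def F_def coloured_def colourables_def
      by (intro sum.cong arg_cong[where f = card]) auto
    also have "\<dots> = (\<Sum>M\<in>F. card {\<gamma> \<in> \<Gamma>. M \<in> coloured n \<gamma> \<and> good s S M \<gamma>})"
      using fin\<Gamma> finC unfolding F_def by (intro sum_multicount_gen) auto
    also have "\<dots> \<le> (\<Sum>M\<in>F. l ^ l)"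
    proof (rule sum_mono)
      fix M assume "M \<in> F"
      then obtain \<gamma>0 where M: "is_struct ar M" "universe M = {1..n}"
        and \<gamma>0: "col l M \<gamma>0" "good s S M \<gamma>0" by (auto simp: F_def colourables_def)
      let ?Q = "{1..l} \<rightarrow>\<^sub>E {1..l}"
      \<comment> \<open>By \<open>good_factorization\<close> every colouring of \<open>M\<close> is
        the one good colouring \<open>\<gamma>0\<close> followed by a map of the colours.\<close>
      have "{\<gamma> \<in> \<Gamma>. M \<in> coloured n \<gamma> \<and> good s S M \<gamma>} \<subseteq> (\<lambda>p. restrict (p \<circ> \<gamma>0) {1..n}) ` ?Q"
      proof
        fix \<gamma> assume \<gamma>: "\<gamma> \<in> {\<gamma> \<in> \<Gamma>. M \<in> coloured n \<gamma> \<and> good s S M \<gamma>}"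
        then obtain p where p: "bij_betw p {1..l} {1..l}" "\<And>a. a \<in> universe M \<Longrightarrow> \<gamma> a = p (\<gamma>0 a)"
          using good_factorization[OF S M(1) \<gamma>0(2,1)] unfolding coloured_def by blast
        have "restrict p {1..l} \<in> ?Q" using bij_betwE[OF p(1)] by auto
        moreover have "\<gamma> = restrict (restrict p {1..l} \<circ> \<gamma>0) {1..n}"
        proof
          fix a show "\<gamma> a = restrict (restrict p {1..l} \<circ> \<gamma>0) {1..n} a"
          proof (cases "a \<in> {1..n}")
            case True
            then show ?thesis using p(2)[of a] \<gamma>0(1) M(2) by (simp add: col_iff)
          next
            case False
            then show ?thesis using \<gamma> by (auto simp: \<Gamma>_def PiE_def extensional_def)
          qed
        qed
        ultimately show "\<gamma> \<in> (\<lambda>p. restrict (p \<circ> \<gamma>0) {1..n}) ` ?Q" by blast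
      qed
      then have "card {\<gamma> \<in> \<Gamma>. M \<in> coloured n \<gamma> \<and> good s S M \<gamma>} \<le> card ?Q"
        by (intro surj_card_le) (auto simp: finite_PiE)
      then show "card {\<gamma> \<in> \<Gamma>. M \<in> coloured n \<gamma> \<and> good s S M \<gamma>} \<le> l ^ l"
        by (simp add: card_PiE)
    qed
    finally show ?thesis by (simp add: mult.commute)
  qed
  moreover have "card F \<le> card ?C" unfolding F_def using finC by (intro card_mono) auto
  ultimately have "G \<le> l ^ l * card ?C" by (meson le_trans mult_le_mono2)
  then have G: "real G \<le> real (l ^ l) * real (card ?C)" by (metis of_nat_le_iff of_nat_mult)
  \<comment> \<open>As \<open>\<epsilon> \<le> 1 / 2\<close>, at least half of all pairs are good,
    so the bound on \<open>G\<close> also bounds \<open>N\<close>.\<close>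
  have "\<epsilon> * real N \<le> 1 / 2 * real N" using \<epsilon>(2) by (intro mult_right_mono) auto
  then have "real N \<le> 2 * (real (l ^ l) * real (card ?C))" using B G NGB by linarith
  then have "\<epsilon> * real N \<le> \<epsilon> * (2 * (real (l ^ l) * real (card ?C)))" using \<epsilon>0 by (rule mult_left_mono)
  then have B': "real B \<le> 2 * \<epsilon> * real (l ^ l) * real (card ?C)" using B by (simp add: mult_ac)
  have "H - F \<subseteq> (\<Union>\<gamma>\<in>\<Gamma>. {M \<in> coloured n \<gamma>. \<not> good s S M \<gamma>})"
  proof
    fix M assume "M \<in> H - F"
    then obtain \<gamma> where M: "is_struct ar M" "universe M = {1..n}" "M \<notin> F" "M \<in> ?C"
      and \<gamma>: "col l M \<gamma>" "rich l x M \<gamma>" by (auto simp: H_def colourables_def)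
    \<comment> \<open>Restriction makes the rich colouring extensional, hence a member of
      \<open>\<Gamma>\<close>; it cannot be good because \<open>M\<close> is not in
      \<open>F\<close>.\<close>
    let ?\<gamma> = "restrict \<gamma> {1..n}"
    have "map ?\<gamma> xs = map \<gamma> xs" if "xs \<in> interp M R" for R xs
    proof -
      have "set xs \<subseteq> {1..n}" using M(1,2) that unfolding is_struct_def by metis
      then show ?thesis by (intro map_cong) auto
    qed
    then have "ok (map ?\<gamma> xs)" if "xs \<in> interp M R" for R xs
      using \<gamma>(1) that unfolding col_iff by metis
    then have "col l M ?\<gamma>" using \<gamma>(1) M(2) by (simp add: col_iff)
    moreover have "?\<gamma> \<in> \<Gamma>"
    proof -
      have "{a \<in> {1..n}. ?\<gamma> a = i} = {a \<in> {1..n}. \<gamma> a = i}" for i by auto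
      then show ?thesis using \<gamma> M(2) unfolding \<Gamma>_def rich_def col_iff
        by (auto simp: nat_le_iff ceiling_le_iff)
    qed
    moreover have "\<not> good s S M ?\<gamma>" using M(3,4) calculation(1) unfolding F_def by blast
    ultimately show "M \<in> (\<Union>\<gamma>\<in>\<Gamma>. {M \<in> coloured n \<gamma>. \<not> good s S M \<gamma>})"
      using M(1,2) unfolding coloured_def by blast
  qed
  then have "card (H - F) \<le> card (\<Union>\<gamma>\<in>\<Gamma>. {M \<in> coloured n \<gamma>. \<not> good s S M \<gamma>})"
    using fin\<Gamma> finite_coloured[OF \<Gamma>l] by (intro card_mono) auto
  also have "\<dots> \<le> B" unfolding B_def by (rule card_UN_le[OF fin\<Gamma>])
  finally have "card (H - F) \<le> B" .
  moreover have "card H - card F \<le> card (H - F)"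
    using finC unfolding F_def by (intro diff_card_le_card_Diff) auto
  ultimately have "card H \<le> card F + B" by linarith
  then have "real (card H) \<le> real (card F) + real B" by linarith
  then have "real (card H) \<le> real (card F) + 2 * \<epsilon> * real (l ^ l) * real (card ?C)" using B' by linarith
  \<comment> \<open>If there are no colourable structures, both quotients are 0 by the convention on
    division.\<close>
  then have "real (card H) / real (card ?C) \<le> real (card F) / real (card ?C) + 2 * \<epsilon> * real (l ^ l)"
    using \<epsilon>0 by (cases "card ?C = 0") (auto simp: field_simps)
  then show ?thesis unfolding proportion_def F_def H_def by simp
qed


section \<open>Passage to the limit\<close>

lemma almost_all_good:
  assumes S: "forcing_struct ar col l s S"
    and f: "filterlim (\<lambda>n. f n / ln (real n)) at_top sequentially"
    and rich: "(\<lambda>n. proportion (colourables ar col l n)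
      (\<lambda>M. \<exists>\<gamma>. col l M \<gamma> \<and> rich l (f n) M \<gamma>)) \<longlonglongrightarrow> 1"
  shows "(\<lambda>n. proportion (colourables ar col l n) (\<lambda>M. \<exists>\<gamma>. col l M \<gamma> \<and> good s S M \<gamma>)) \<longlonglongrightarrow> 1"
proof (rule tendsto_sandwich[OF _ _ _ tendsto_const])
  define d where "d = Suc (card (tuples {1..s}))"
  define t where "t n = (nat \<lceil>f n\<rceil> - 2) div s" for n
  define \<epsilon> where "\<epsilon> n = real (n\<^sup>2 + l\<^sup>2) * (1 - 1 / 2 ^ d) ^ t n" for n
  have s: "0 < s" using S by (simp add: forcing_struct_def)
  have "(1::real) < 2 ^ d" unfolding d_def by (intro one_less_power) auto
  then have "\<epsilon> \<longlonglongrightarrow> 0"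
    unfolding \<epsilon>_def t_def by (intro quadratic_times_power_tendsto_0 s f) (auto simp: field_simps)
  then have "(\<lambda>n. proportion (colourables ar col l n) (\<lambda>M. \<exists>\<gamma>. col l M \<gamma> \<and> rich l (f n) M \<gamma>)
      - 2 * \<epsilon> n * real (l ^ l)) \<longlonglongrightarrow> 1 - 2 * 0 * real (l ^ l)"
    by (intro tendsto_intros rich)
  then show "(\<lambda>n. proportion (colourables ar col l n) (\<lambda>M. \<exists>\<gamma>. col l M \<gamma> \<and> rich l (f n) M \<gamma>)
      - 2 * \<epsilon> n * real (l ^ l)) \<longlonglongrightarrow> 1" by simp
  have "eventually (\<lambda>n. \<epsilon> n < 1 / 2) sequentially"
    using \<open>\<epsilon> \<longlonglongrightarrow> 0\<close> by (rule order_tendstoD) simp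
  then show "eventually (\<lambda>n.
      proportion (colourables ar col l n) (\<lambda>M. \<exists>\<gamma>. col l M \<gamma> \<and> rich l (f n) M \<gamma>)
        - 2 * \<epsilon> n * real (l ^ l)
      \<le> proportion (colourables ar col l n) (\<lambda>M. \<exists>\<gamma>. col l M \<gamma> \<and> good s S M \<gamma>)) sequentially"
    using eventually_ge_mult_ln[OF f, of 2]
  proof eventually_elim
    case (elim n)
    \<comment> \<open>From here on the truncated subtraction in \<open>t n\<close> is a genuine
      one.\<close>
    have "2 \<le> f n" using elim by linarith
    then have "2 \<le> nat \<lceil>f n\<rceil>" by linarith
    moreover have "t n * s \<le> nat \<lceil>f n\<rceil> - 2" unfolding t_def by simp
    ultimately have "t n * s + 2 \<le> nat \<lceil>f n\<rceil>" by linarith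
    then show ?case using proportion_good_ge[OF S _ d_def \<epsilon>_def] elim by simp
  qed
qed (intro always_eventually allI proportion_le_1 finite_colourables)

lemma almost_all_definable:
  assumes S: "forcing_struct ar col l s S" and d: "describes ar s S \<chi>"
    and f: "filterlim (\<lambda>n. f n / ln (real n)) at_top sequentially"
    and rich: "(\<lambda>n. proportion (colourables ar col l n)
      (\<lambda>M. \<exists>\<gamma>. col l M \<gamma> \<and> rich l (f n) M \<gamma>)) \<longlonglongrightarrow> 1"
  shows "(\<lambda>n. proportion (colourables ar col l n)
      (\<lambda>M. \<forall>\<gamma>. col l M \<gamma> \<longrightarrow> definable_by (xi s \<chi>) (s - 1) s M \<gamma>)) \<longlonglongrightarrow> 1"
proof (rule tendsto_sandwich[OF _ _ almost_all_good[OF S f rich] tendsto_const])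
  show "eventually (\<lambda>n. proportion (colourables ar col l n) (\<lambda>M. \<exists>\<gamma>. col l M \<gamma> \<and> good s S M \<gamma>)
      \<le> proportion (colourables ar col l n)
        (\<lambda>M. \<forall>\<gamma>. col l M \<gamma> \<longrightarrow> definable_by (xi s \<chi>) (s - 1) s M \<gamma>)) sequentially"
    using good_definable[OF S d]
    by (intro always_eventually allI proportion_mono finite_colourables)
       (auto simp: colourables_def)
qed (intro always_eventually allI proportion_le_1 finite_colourables)

lemma almost_all_unique:
  assumes S: "forcing_struct ar col l s S"
    and f: "filterlim (\<lambda>n. f n / ln (real n)) at_top sequentially"
    and rich: "(\<lambda>n. proportion (colourables ar col l n)
      (\<lambda>M. \<exists>\<gamma>. col l M \<gamma> \<and> rich l (f n) M \<gamma>)) \<longlonglongrightarrow> 1"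
  shows "(\<lambda>n. proportion (colourables ar col l n) (unique_colouring col l)) \<longlonglongrightarrow> 1"
proof (rule tendsto_sandwich[OF _ _ almost_all_good[OF S f rich] tendsto_const])
  show "eventually (\<lambda>n. proportion (colourables ar col l n) (\<lambda>M. \<exists>\<gamma>. col l M \<gamma> \<and> good s S M \<gamma>)
      \<le> proportion (colourables ar col l n) (unique_colouring col l)) sequentially"
    using good_unique_colouring[OF S]
    by (intro always_eventually allI proportion_mono finite_colourables)
       (auto simp: colourables_def)
qed (intro always_eventually allI proportion_le_1 finite_colourables)

subsection \<open>Existence of forcing structures\<close>

text \<open>
  The structure consists of all injective tuples of one symbol inside \<open>W \<union> {y}\<close> or inside
  \<open>W \<union> {z}\<close>, where \<open>W\<close> has \<open>l * w - 1\<close> elements and \<open>w\<close> is the largest possible size of a colour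
  class on such a complete structure. Every class then meets \<open>W \<union> {y}\<close> and \<open>W \<union> {z}\<close> in exactly
  \<open>w\<close> elements, so \<open>y\<close> and \<open>z\<close> both have the only colour that is deficient on \<open>W\<close>.
\<close>

lemma forcing_struct_exists:
  assumes l: "2 \<le> l" and w: "1 \<le> w"
    and ok: "\<And>\<gamma> (xs :: nat list). distinct xs \<Longrightarrow> length xs = ar R \<Longrightarrow>
      (\<And>c. card {x \<in> set xs. \<gamma> x = c} \<le> w) \<Longrightarrow> ok (map \<gamma> xs)"
    and bound: "\<And>\<gamma> (A :: nat set) c. card A = l * w \<Longrightarrow>
      (\<And>xs. distinct xs \<Longrightarrow> length xs = ar R \<Longrightarrow> set xs \<subseteq> A \<Longrightarrow> ok (map \<gamma> xs)) \<Longrightarrow>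
      card {a \<in> A. \<gamma> a = c} \<le> w"
  obtains s S where "forcing_struct ar col l s S"
proof -
  define m where "m = l * w"
  \<comment> \<open>With \<open>W = {1..m - 1}\<close>, \<open>A\<close> is \<open>W\<close> with
    \<open>y = m\<close> and \<open>B\<close> is \<open>W\<close> with \<open>z = Suc m\<close>; the
    last two vertices \<open>s - 1\<close> and \<open>s\<close> are thus \<open>y\<close> and
    \<open>z\<close>.\<close>
  define A where "A = {1..m}"
  define B where "B = {1..Suc m} - {m}"
  define S :: "('r, nat) rstruct" where "S = \<lparr>universe = {1..Suc m}, interp = (\<lambda>R'.
     {xs. R' = R \<and> distinct xs \<and> length xs = ar R \<and> (set xs \<subseteq> A \<or> set xs \<subseteq> B)})\<rparr>"
  have m: "2 \<le> m" using mult_le_mono[OF l w] by (simp add: m_def)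
  have cA: "card A = l * w" by (simp add: A_def m_def)
  have "card B = card {1..Suc m} - card {m}"
    unfolding B_def using m by (intro card_Diff_subset) auto
  then have cB: "card B = l * w" by (simp add: m_def)
  have AB: "A \<subseteq> universe S" "B \<subseteq> universe S" "finite A" "finite B"
    by (auto simp: A_def B_def S_def)
  have str: "is_struct ar S" using AB by (auto simp: is_struct_def S_def)
  have forced: "\<gamma> m = \<gamma> (Suc m)" if \<gamma>: "col l S \<gamma>" for \<gamma>
  proof (rule ccontr)
    assume ne: "\<gamma> m \<noteq> \<gamma> (Suc m)"
    have full: "card {a \<in> V. \<gamma> a = \<gamma> m} = w" if V: "V = A \<or> V = B" for V
    proof (rule balanced_class_card)
      show "finite V" "card V = l * w" using V cA cB AB by auto
      show "\<gamma> ` V \<subseteq> {1..l}" using V \<gamma> AB unfolding col_iff by blast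
      show "card {a \<in> V. \<gamma> a = c} \<le> w" for c
      proof (rule bound[OF \<open>card V = l * w\<close>])
        fix xs assume "distinct xs" "length xs = ar R" "set xs \<subseteq> V"
        then have "xs \<in> interp S R" using V by (auto simp: S_def)
        then show "ok (map \<gamma> xs)" using \<gamma> by (simp add: col_iff)
      qed
      have "m \<in> universe S" using m by (simp add: S_def)
      then show "\<gamma> m \<in> {1..l}" using \<gamma> by (simp add: col_iff)
    qed
    \<comment> \<open>\<open>B\<close> arises from \<open>A\<close> by exchanging \<open>m\<close>
      for \<open>Suc m\<close>; if the latter has another colour, the class of \<open>m\<close>
      shrinks by one, although it has \<open>w\<close> elements in both sets.\<close>
    have "{a \<in> A. \<gamma> a = \<gamma> m} = insert m {a \<in> B. \<gamma> a = \<gamma> m}"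
      using ne m by (auto simp: A_def B_def le_Suc_eq)
    moreover have "m \<notin> {a \<in> B. \<gamma> a = \<gamma> m}" by (simp add: B_def)
    ultimately have "card {a \<in> A. \<gamma> a = \<gamma> m} = Suc (card {a \<in> B. \<gamma> a = \<gamma> m})"
      using AB(4) by simp
    then show False using full[of A] full[of B] by simp
  qed
  have ex: "\<exists>\<gamma>. col l S \<gamma> \<and> \<gamma> m = i \<and> \<gamma> (Suc m) = i" if i: "i \<in> {1..l}" for i
  proof -
    \<comment> \<open>Consecutive blocks of length \<open>w\<close> get the colours 1 to
      \<open>l\<close>, so \<open>m\<close> ends the block of colour \<open>l\<close>, and
      \<open>Suc m\<close> gets colour \<open>l\<close> too. Transposing \<open>l\<close> and
      \<open>i\<close> then moves both to colour \<open>i\<close>.\<close>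
    define \<gamma>0 where "\<gamma>0 k = (if k = Suc m then l else Suc ((k - 1) div w))" for k
    define \<gamma> where "\<gamma> = transpose l i \<circ> \<gamma>0"
    have "(m - 1) div w = l - 1"
    proof (rule div_nat_eqI)
      show "w * (l - 1) \<le> m - 1" "m - 1 < w * Suc (l - 1)"
        using l w by (cases l; simp add: m_def mult.commute)+
    qed
    then have \<gamma>0m: "\<gamma>0 m = l" "\<gamma>0 (Suc m) = l" using l by (simp_all add: \<gamma>0_def)
    have range0: "\<gamma>0 k \<in> {1..l}" if "k \<in> {1..Suc m}" for k
    proof (cases "k = Suc m")
      case False
      then have "k - 1 < l * w" using that m by (auto simp: m_def)
      then have "(k - 1) div w < l" by (simp add: less_mult_imp_div_less)
      then show ?thesis using False by (simp add: \<gamma>0_def)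
    qed (use l in \<open>simp add: \<gamma>0_def\<close>)
    have clA: "card {k \<in> A. \<gamma>0 k = c} \<le> w" for c
    proof -
      have "{k \<in> A. \<gamma>0 k = c} \<subseteq> {(c - 1) * w + 1..(c - 1) * w + w}"
      proof
        fix k assume k: "k \<in> {k \<in> A. \<gamma>0 k = c}"
        then have "(k - 1) div w = c - 1" by (auto simp: A_def \<gamma>0_def)
        then have "k - 1 = (c - 1) * w + (k - 1) mod w" by (metis div_mult_mod_eq)
        moreover have "(k - 1) mod w < w" using w by simp
        moreover have "1 \<le> k" using k by (simp add: A_def)
        ultimately have "(c - 1) * w + 1 \<le> k \<and> k \<le> (c - 1) * w + w" by linarith
        then show "k \<in> {(c - 1) * w + 1..(c - 1) * w + w}" by simp
      qed
      then have "card {k \<in> A. \<gamma>0 k = c} \<le> card {(c - 1) * w + 1..(c - 1) * w + w}"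
        by (intro card_mono) auto
      then show ?thesis by simp
    qed
    have clB: "card {k \<in> B. \<gamma>0 k = c} \<le> w" for c
    proof -
      \<comment> \<open>Replacing \<open>m\<close> by \<open>Suc m\<close>, which has the same
        colour, carries the classes on \<open>A\<close> to those on \<open>B\<close>.\<close>
      have "{k \<in> B. \<gamma>0 k = c} \<subseteq> (\<lambda>k. if k = m then Suc m else k) ` {k \<in> A. \<gamma>0 k = c}"
      proof
        fix k assume k: "k \<in> {k \<in> B. \<gamma>0 k = c}"
        show "k \<in> (\<lambda>k. if k = m then Suc m else k) ` {k \<in> A. \<gamma>0 k = c}"
        proof (cases "k = Suc m")
          case True
          then show ?thesis using k \<gamma>0m m by (intro image_eqI[of _ _ m]) (auto simp: A_def)
        next
          case False
          then show ?thesis using k by (intro image_eqI[of _ _ k]) (auto simp: A_def B_def)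
        qed
      qed
      then have "card {k \<in> B. \<gamma>0 k = c} \<le> card {k \<in> A. \<gamma>0 k = c}"
        by (rule surj_card_le[rotated]) (use AB(3) in simp)
      then show ?thesis using clA[of c] by linarith
    qed
    have "col l S \<gamma>"
      unfolding col_iff
    proof (intro conjI ballI allI)
      fix k assume "k \<in> universe S"
      then have "\<gamma>0 k \<in> {1..l}" using range0 by (simp add: S_def)
      then show "\<gamma> k \<in> {1..l}" using i l by (auto simp: \<gamma>_def transpose_def)
    next
      fix R' xs assume "xs \<in> interp S R'"
      then have xs: "distinct xs" "length xs = ar R" "set xs \<subseteq> A \<or> set xs \<subseteq> B"
        by (auto simp: S_def)
      have "card {x \<in> set xs. \<gamma> x = c} \<le> w" for c
      proof -
        let ?c = "transpose l i c"
        have "\<gamma>0 x = ?c" if "\<gamma> x = c" for x using that by (auto simp: \<gamma>_def)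
        then have "{x \<in> set xs. \<gamma> x = c} \<subseteq> {x \<in> A. \<gamma>0 x = ?c} \<or> {x \<in> set xs. \<gamma> x = c} \<subseteq> {x \<in> B. \<gamma>0 x = ?c}"
          using xs(3) by blast
        then have "card {x \<in> set xs. \<gamma> x = c} \<le> card {x \<in> A. \<gamma>0 x = ?c} \<or>
            card {x \<in> set xs. \<gamma> x = c} \<le> card {x \<in> B. \<gamma>0 x = ?c}"
          by (rule disj_forward; intro card_mono) (use AB(3,4) in simp_all)
        then show ?thesis using clA[of ?c] clB[of ?c] by linarith
      qed
      then show "ok (map \<gamma> xs)" by (rule ok[OF xs(1,2)])
    qed
    then show ?thesis using \<gamma>0m by (auto simp: \<gamma>_def)
  qed
  have "\<exists>\<gamma>. col l S \<gamma>" using ex[of 1] l by auto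
  then have "forcing_struct ar col l (Suc m) S"
    using m str forced ex by (simp add: forcing_struct_def S_def)
  then show thesis by (rule that)
qed

end

section \<open>The two notions of colouring as instances\<close>

lemma colour_notion_colouring:
  fixes ar :: "'r::finite \<Rightarrow> nat"
  assumes "\<And>R. 2 \<le> ar R"
  shows "colour_notion ar l
    (\<lambda>cs. \<exists>i < length cs. \<exists>j < length cs. cs ! i \<noteq> cs ! j) colouring"
proof
  show "colouring l M \<gamma> \<longleftrightarrow> (\<forall>a \<in> universe M. \<gamma> a \<in> {1..l}) \<and> (\<forall>R. \<forall>xs \<in> interp M R.
      \<exists>i < length (map \<gamma> xs). \<exists>j < length (map \<gamma> xs). map \<gamma> xs ! i \<noteq> map \<gamma> xs ! j)"
    for M :: "('r, nat) rstruct" and \<gamma>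
    unfolding colouring_def
    by (simp cong: conj_cong)
  show "\<not> (\<exists>i < length cs. \<exists>j < length cs. cs ! i \<noteq> cs ! j)" if "set cs \<subseteq> {c}" for cs and c :: nat
    using that by (metis nth_mem singletonD subsetD)
  fix i j :: nat assume ij: "i \<in> {1..l}" "j \<in> {1..l}" "i \<noteq> j"
  \<comment> \<open>Types are inhabited, so the vocabulary contains a symbol.\<close>
  fix R :: 'r
  \<comment> \<open>One entry \<open>i\<close> and all others \<open>j\<close>: merging the two
    colours makes the tuple monochromatic.\<close>
  let ?cs = "i # replicate (ar R - 1) j"
  have 2: "2 \<le> ar R" by (rule assms)
  have const: "map p ?cs = replicate (ar R) (p j)" if "p i = p j" for p :: "nat \<Rightarrow> nat"
    using 2 that by (cases "ar R") auto
  have "length ?cs = ar R" using 2 by simp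
  moreover have "set ?cs \<subseteq> {1..l}" using ij by auto
  moreover have "\<exists>k < length ?cs. \<exists>k' < length ?cs. ?cs ! k \<noteq> ?cs ! k'"
    using 2 ij(3) by (intro exI[of _ 0] exI[of _ 1] conjI) auto
  moreover have "\<not> (\<exists>k < length (map p ?cs). \<exists>k' < length (map p ?cs). map p ?cs ! k \<noteq> map p ?cs ! k')"
    if "p i = p j" for p :: "nat \<Rightarrow> nat"
    unfolding const[OF that] by simp
  ultimately show "\<exists>R cs. length cs = ar R \<and> set cs \<subseteq> {1..l} \<and>
      (\<exists>k < length cs. \<exists>k' < length cs. cs ! k \<noteq> cs ! k') \<and>
      (\<forall>p :: nat \<Rightarrow> nat. p i = p j \<longrightarrow>
        \<not> (\<exists>k < length (map p cs). \<exists>k' < length (map p cs). map p cs ! k \<noteq> map p cs ! k'))"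
    by blast
qed (use assms in auto)

lemma colour_notion_strong_colouring:
  fixes ar :: "'r::finite \<Rightarrow> nat"
  assumes ar: "\<And>R. 2 \<le> ar R" "\<And>R. ar R \<le> l"
  shows "colour_notion ar l distinct strong_colouring"
proof
  show "strong_colouring l M \<gamma> \<longleftrightarrow>
      (\<forall>a \<in> universe M. \<gamma> a \<in> {1..l}) \<and> (\<forall>R. \<forall>xs \<in> interp M R. distinct (map \<gamma> xs))"
    for M :: "('r, nat) rstruct" and \<gamma>
    by (simp add: strong_colouring_def distinct_conv_nth)
  show "\<not> distinct cs" if "2 \<le> length cs" "set cs \<subseteq> {c}" for cs and c :: nat
  proof
    assume "distinct cs"
    then have "length cs = card (set cs)" by (simp add: distinct_card)
    also have "\<dots> \<le> card {c}" using that(2) by (intro card_mono) auto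
    finally show False using that(1) by simp
  qed
  fix i j :: nat assume ij: "i \<in> {1..l}" "j \<in> {1..l}" "i \<noteq> j"
  fix R :: 'r
  \<comment> \<open>Since \<open>2 \<le> ar R \<le> l\<close>, a tuple of distinct colours can
    contain both \<open>i\<close> and \<open>j\<close>; merging them produces a repetition.\<close>
  obtain T where T: "{i, j} \<subseteq> T" "T \<subseteq> {1..l}" "card T = ar R"
    using exists_subset_between[of "{i, j}" "ar R" "{1..l}"] ar[of R] ij by auto
  then obtain cs where cs: "set cs = T" "distinct cs"
    using finite_distinct_list finite_subset finite_atLeastAtMost by metis
  have "length cs = ar R" using cs T(3) by (metis distinct_card)
  moreover have "\<not> distinct (map p cs)" if "p i = p j" for p :: "nat \<Rightarrow> nat"
    using that T(1) cs(1) ij(3) by (auto simp: distinct_map inj_on_def)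
  ultimately show "\<exists>R cs. length cs = ar R \<and> set cs \<subseteq> {1..l} \<and> distinct cs \<and>
      (\<forall>p :: nat \<Rightarrow> nat. p i = p j \<longrightarrow> \<not> distinct (map p cs))"
    using cs T(2) by (intro exI[of _ R] exI[of _ cs]) auto
qed (rule ar)

text \<open>Here \<open>w = ar R - 1\<close>: a class with \<open>ar R\<close> elements would
  contain a monochromatic injective tuple, while a smaller class cannot fill one.\<close>

lemma forcing_struct_colouring_exists:
  fixes ar :: "'r::finite \<Rightarrow> nat"
  assumes ar: "\<And>R. 2 \<le> ar R" and l: "2 \<le> l"
  obtains s S where "forcing_struct ar colouring l s S"
proof -
  interpret colour_notion ar l "\<lambda>cs. \<exists>i < length cs. \<exists>j < length cs. cs ! i \<noteq> cs ! j" colouring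
    by (rule colour_notion_colouring[OF ar])
  fix R :: 'r
  have R: "2 \<le> ar R" by (rule ar)
  show thesis
  proof (rule forcing_struct_exists[OF l, of "ar R - 1" R])
    show "1 \<le> ar R - 1" using R by simp
  next
    fix \<gamma> :: "nat \<Rightarrow> nat" and xs
    assume xs: "distinct xs" "length xs = ar R" and le: "\<And>c. card {x \<in> set xs. \<gamma> x = c} \<le> ar R - 1"
    show "\<exists>i < length (map \<gamma> xs). \<exists>j < length (map \<gamma> xs). map \<gamma> xs ! i \<noteq> map \<gamma> xs ! j"
    proof (rule ccontr)
      assume no: "\<not> ?thesis"
      have "\<gamma> x = \<gamma> (xs ! 0)" if x: "x \<in> set xs" for x
      proof -
        obtain i where "i < length xs" "xs ! i = x" using x by (auto simp: in_set_conv_nth)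
        moreover have "0 < length xs" using xs(2) R by simp
        ultimately show ?thesis using no by (metis length_map nth_map)
      qed
      then have "{x \<in> set xs. \<gamma> x = \<gamma> (xs ! 0)} = set xs" by blast
      then show False using le[of "\<gamma> (xs ! 0)"] distinct_card[OF xs(1)] xs(2) R by simp
    qed
  next
    fix \<gamma> :: "nat \<Rightarrow> nat" and A :: "nat set" and c
    assume edges: "\<And>xs. distinct xs \<Longrightarrow> length xs = ar R \<Longrightarrow> set xs \<subseteq> A \<Longrightarrow>
      \<exists>i < length (map \<gamma> xs). \<exists>j < length (map \<gamma> xs). map \<gamma> xs ! i \<noteq> map \<gamma> xs ! j"
    show "card {a \<in> A. \<gamma> a = c} \<le> ar R - 1"
    proof (rule ccontr)
      assume "\<not> ?thesis"
      then have "ar R \<le> card {a \<in> A. \<gamma> a = c}" by simp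
      then obtain T where T: "T \<subseteq> {a \<in> A. \<gamma> a = c}" "card T = ar R" "finite T"
        by (rule obtain_subset_with_card_n)
      obtain xs where xs: "set xs = T" "distinct xs" using finite_distinct_list[OF T(3)] by blast
      have "length xs = ar R" using xs T(2) by (metis distinct_card)
      moreover have "set xs \<subseteq> A" "set (map \<gamma> xs) \<subseteq> {c}" using xs T(1) by auto
      ultimately show False using edges[of xs] xs(2) not_ok_const[of "map \<gamma> xs" c] R by simp
    qed
  qed (rule that)
qed

text \<open>Here \<open>w = 1\<close>: as \<open>ar R \<le> l\<close>, any two vertices among
  \<open>l\<close> lie in a common injective tuple, so a strong colouring is injective on
  them.\<close>

lemma forcing_struct_strong_colouring_exists:
  fixes ar :: "'r::finite \<Rightarrow> nat"
  assumes ar: "\<And>R. 2 \<le> ar R" "\<And>R. ar R \<le> l"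
  obtains s S where "forcing_struct ar strong_colouring l s S"
proof -
  interpret colour_notion ar l distinct strong_colouring
    by (rule colour_notion_strong_colouring[OF ar])
  fix R :: 'r
  have R: "2 \<le> ar R" "ar R \<le> l" by (rule ar)+
  then have l: "2 \<le> l" by linarith
  show thesis
  proof (rule forcing_struct_exists[OF l, of 1 R])
    fix \<gamma> :: "nat \<Rightarrow> nat" and xs
    assume xs: "distinct xs" and le: "\<And>c. card {x \<in> set xs. \<gamma> x = c} \<le> 1"
    have "x = y" if "x \<in> set xs" "y \<in> set xs" "\<gamma> x = \<gamma> y" for x y
    proof -
      have "{x, y} \<subseteq> {z \<in> set xs. \<gamma> z = \<gamma> x}" using that by auto
      then have "card {x, y} \<le> 1" using le[of "\<gamma> x"] card_mono[of "{z \<in> set xs. \<gamma> z = \<gamma> x}" "{x, y}"] by simp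
      then show ?thesis by (cases "x = y") auto
    qed
    then show "distinct (map \<gamma> xs)" using xs by (auto simp: distinct_map inj_on_def)
  next
    fix \<gamma> :: "nat \<Rightarrow> nat" and A :: "nat set" and c
    assume A: "card A = l * 1" and edges: "\<And>xs. distinct xs \<Longrightarrow> length xs = ar R \<Longrightarrow> set xs \<subseteq> A \<Longrightarrow>
      distinct (map \<gamma> xs)"
    have fin: "finite A" using A l by (intro card_ge_0_finite) simp
    show "card {a \<in> A. \<gamma> a = c} \<le> 1"
    proof (rule ccontr)
      assume "\<not> ?thesis"
      then obtain T0 where "T0 \<subseteq> {a \<in> A. \<gamma> a = c}" "card T0 = 2"
        using obtain_subset_with_card_n[of 2 "{a \<in> A. \<gamma> a = c}"] by auto
      then obtain x y where xy: "x \<noteq> y" "{x, y} \<subseteq> A" "\<gamma> x = c" "\<gamma> y = c"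
        by (auto simp: card_2_iff)
      obtain T where T: "{x, y} \<subseteq> T" "T \<subseteq> A" "card T = ar R"
        using exists_subset_between[of "{x, y}" "ar R" A] R A xy fin by auto
      obtain xs where xs: "set xs = T" "distinct xs"
        using finite_distinct_list finite_subset[OF T(2) fin] by blast
      have "length xs = ar R" using xs T(3) by (metis distinct_card)
      then have "distinct (map \<gamma> xs)" using edges xs T(2) by simp
      then show False using xy T(1) xs(1) by (auto simp: distinct_map inj_on_def)
    qed
  qed (use that in auto)
qed

theorem proposition9p20:
  fixes ar :: "'r::finite \<Rightarrow> nat" and l :: nat and f :: "nat \<Rightarrow> real"
  assumes "\<And>R. 2 \<le> ar R"
    and "2 \<le> l"
    and "filterlim (\<lambda>n. f n / ln (real n)) at_top sequentially"
  shows
    "((\<lambda>n. proportion (colourables ar colouring l n)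
             (\<lambda>M. \<exists>\<gamma>. colouring l M \<gamma> \<and> rich l (f n) M \<gamma>)) \<longlonglongrightarrow> 1 \<longrightarrow>
        (\<forall>s S \<chi>. forcing_struct ar colouring l s S \<and> describes ar s S \<chi> \<longrightarrow>
           (\<lambda>n. proportion (colourables ar colouring l n)
             (\<lambda>M. \<forall>\<gamma>. colouring l M \<gamma> \<longrightarrow> definable_by (xi s \<chi>) (s - 1) s M \<gamma>)) \<longlonglongrightarrow> 1) \<and>
        (\<lambda>n. proportion (colourables ar colouring l n) (unique_colouring colouring l)) \<longlonglongrightarrow> 1)
     \<and>
     ((\<forall>R. ar R \<le> l) \<longrightarrow>
      (\<lambda>n. proportion (colourables ar strong_colouring l n)
             (\<lambda>M. \<exists>\<gamma>. strong_colouring l M \<gamma> \<and> rich l (f n) M \<gamma>)) \<longlonglongrightarrow> 1 \<longrightarrow>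
        (\<forall>s S \<chi>. forcing_struct ar strong_colouring l s S \<and> describes ar s S \<chi> \<longrightarrow>
           (\<lambda>n. proportion (colourables ar strong_colouring l n)
             (\<lambda>M. \<forall>\<gamma>. strong_colouring l M \<gamma> \<longrightarrow> definable_by (xi s \<chi>) (s - 1) s M \<gamma>)) \<longlonglongrightarrow> 1) \<and>
        (\<lambda>n. proportion (colourables ar strong_colouring l n) (unique_colouring strong_colouring l)) \<longlonglongrightarrow> 1)"
proof (intro conjI impI allI; (elim conjE)?)
  interpret colour_notion ar l "\<lambda>cs. \<exists>i < length cs. \<exists>j < length cs. cs ! i \<noteq> cs ! j" colouring
    by (rule colour_notion_colouring[OF assms(1)])
  assume rich: "(\<lambda>n. proportion (colourables ar colouring l n)
             (\<lambda>M. \<exists>\<gamma>. colouring l M \<gamma> \<and> rich l (f n) M \<gamma>)) \<longlonglongrightarrow> 1"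
  show "(\<lambda>n. proportion (colourables ar colouring l n)
      (\<lambda>M. \<forall>\<gamma>. colouring l M \<gamma> \<longrightarrow> definable_by (xi s \<chi>) (s - 1) s M \<gamma>)) \<longlonglongrightarrow> 1"
    if "forcing_struct ar colouring l s S" "describes ar s S \<chi>" for s S \<chi>
    by (rule almost_all_definable[OF that assms(3) rich])
  \<comment> \<open>Uniqueness mentions no forcing structure, so one has to be supplied.\<close>
  obtain s S where "forcing_struct ar colouring l s S"
    by (rule forcing_struct_colouring_exists[OF assms(1,2)])
  then show "(\<lambda>n. proportion (colourables ar colouring l n) (unique_colouring colouring l)) \<longlonglongrightarrow> 1"
    by (rule almost_all_unique[OF _ assms(3) rich])
next
  assume le: "\<forall>R. ar R \<le> l"
  interpret colour_notion ar l distinct strong_colouring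
    using le by (intro colour_notion_strong_colouring assms(1)) blast
  assume rich: "(\<lambda>n. proportion (colourables ar strong_colouring l n)
             (\<lambda>M. \<exists>\<gamma>. strong_colouring l M \<gamma> \<and> rich l (f n) M \<gamma>)) \<longlonglongrightarrow> 1"
  show "(\<lambda>n. proportion (colourables ar strong_colouring l n)
      (\<lambda>M. \<forall>\<gamma>. strong_colouring l M \<gamma> \<longrightarrow> definable_by (xi s \<chi>) (s - 1) s M \<gamma>)) \<longlonglongrightarrow> 1"
    if "forcing_struct ar strong_colouring l s S" "describes ar s S \<chi>" for s S \<chi>
    by (rule almost_all_definable[OF that assms(3) rich])
  obtain s S where "forcing_struct ar strong_colouring l s S"
    by (rule forcing_struct_strong_colouring_exists[OF assms(1) le[rule_format]])
  then show "(\<lambda>n. proportion (colourables ar strong_colouring l n)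
      (unique_colouring strong_colouring l)) \<longlonglongrightarrow> 1"
    by (rule almost_all_unique[OF _ assms(3) rich])
qed

end
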